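(* Let $n\ge 2$. The space $\mathcal H^n-\{\mathbf i\}$ is isometric to the warped product $(1,\infty)\times_{e^{2\phi}}S^{n-1}$, where $(1,\infty)$ has the metric induced from $\{\mathbf 0\}\times(1,\infty)\subset\mathcal H^n$, that is, $\left|\frac{\partial}{\partial t}(t_0)\right|=\frac1{t_0}$ for $t_0\in(1,\infty)$; $S^{n-1}$ has the standard (unit sphere) metric; and $e^{2\phi(t)}=\dfrac{\sinh^2(\ln t)}{\cosh(2\ln t)}$.
   Context: Let $J=\mathrm{diag}(-1,\dots,-1,1)$ (of size $n+1$, with $n$ entries $-1$) and let $G=\mathrm{SO}_0(n,1)$ be the identity component of $\{A\in \mathrm{GL}(n+1,\mathbb R): AJA^t=J\}$. Let $K=\mathrm{SO}(n)\times\{1\}\subset G$ (block diagonal). With $e_{ij}$ the elementary matrices, set $E_{ij}=\epsilon_{ij}e_{ij}+e_{ji}$ for $1\le i<j\le n+1$, where $\epsilon_{ij}=-1$ if $j<n+1$ and $\epsilon_{ij}=1$ if $j=n+1$. Give $G$ the left-invariant Riemannian metric for which $\{E_{ij}\}$ is orthonormal at the identity. $K$ acts on $G$ by left multiplication, freely, properly and isometrically, and $\mathcal H^n=K\backslash G=\mathrm{SO}(n)\backslash\mathrm{SO}_0(n,1)$ carries the unique Riemannian metric making $G\to K\backslash G$ a Riemannian submersion. Global coordinates: let $N_i=E_{i,n}+E_{i,n+1}$ ($1\le i\le n-1$) and $A_1=E_{n,n+1}$. The map $\varphi(\mathbf x,y)=e^{\sum_{i=1}^{n-1}x_iN_i}e^{\ln(y)A_1}$,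 $(\mathbf x,y)\in\mathbb R^{n-1}\times\mathbb R^+$, composed with the projection $G\to K\backslash G$ is a diffeomorphism $\mathbb R^{n-1}\times\mathbb R^+\to\mathcal H^n$, by which points of $\mathcal H^n$ are written $(\mathbf x,y)$. The point $\mathbf i$ is $(\mathbf 0,1)$. For Riemannian manifolds $(B,g_B)$, $(F,g_F)$ and a function $\phi:B\to\mathbb R$, the warped product $B\times_{e^{2\phi}}F$ is $B\times F$ with the metric $g_B+e^{2\phi}g_F$. *)

theory Defs
  imports "HOL-Analysis.Analysis"
begin

section \<open>Smooth maps and tangent vectors of subsets of Euclidean space\<close>

text \<open>On an open set in finite dimension this is the usual class \<open>C\<^sup>k\<close>: all iterated directional
  derivatives of order at most \<open>k\<close> exist and are continuous.\<close>

primrec Ck_on :: "nat \<Rightarrow> 'a::euclidean_space set \<Rightarrow> ('a \<Rightarrow> 'b::euclidean_space) \<Rightarrow> bool" where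
  "Ck_on 0 S f \<longleftrightarrow> continuous_on S f"
| "Ck_on (Suc k) S f \<longleftrightarrow> (\<forall>x\<in>S. f differentiable (at x)) \<and>
     (\<forall>v. Ck_on k S (\<lambda>x. frechet_derivative f (at x) v))"

definition smooth_on_open :: "'a::euclidean_space set \<Rightarrow> ('a \<Rightarrow> 'b::euclidean_space) \<Rightarrow> bool" where
  "smooth_on_open S f \<longleftrightarrow> open S \<and> (\<forall>k. Ck_on k S f)"

definition smooth_map_on :: "'a::euclidean_space set \<Rightarrow> ('a \<Rightarrow> 'b::euclidean_space) \<Rightarrow> bool" where
  "smooth_map_on S f \<longleftrightarrow>
     (\<forall>p\<in>S. \<exists>U F. p \<in> U \<and> smooth_on_open U F \<and> (\<forall>x\<in>S \<inter> U. F x = f x))"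

definition smooth_curve_in :: "'a::euclidean_space set \<Rightarrow> (real \<Rightarrow> 'a) \<Rightarrow> bool" where
  "smooth_curve_in S c \<longleftrightarrow>
     (\<exists>e>0. smooth_on_open {-e<..<e} c \<and> (\<forall>t\<in>{-e<..<e}. c t \<in> S))"

definition tangent_space :: "'a::euclidean_space set \<Rightarrow> 'a \<Rightarrow> 'a set" where
  "tangent_space S p =
     {v. \<exists>c. smooth_curve_in S c \<and> c 0 = p \<and> (c has_vector_derivative v) (at 0)}"

section \<open>Riemannian manifolds, isometries, warped products\<close>

text \<open>A manifold is presented by its point set and an injective map \<open>rm_coords\<close> into a Euclidean
  space whose image is a submanifold: a global chart if the image is open, the inclusion for a
  submanifold of Euclidean space. Smooth structure and tangent vectors are those of the image.
  \<open>rm_metric M p v w\<close> is meaningful for \<open>p \<in> rm_points M\<close> and \<open>v\<close>, \<open>w\<close> tangent to the image at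
  \<open>rm_coords M p\<close>.\<close>

record ('p, 'e) riem =
  rm_points :: "'p set"
  rm_coords :: "'p \<Rightarrow> 'e"
  rm_metric :: "'p \<Rightarrow> 'e \<Rightarrow> 'e \<Rightarrow> real"

definition coord_rep ::
    "('p, 'e) riem \<Rightarrow> ('q, 'f) riem \<Rightarrow> ('p \<Rightarrow> 'q) \<Rightarrow> 'e \<Rightarrow> 'f" where
  "coord_rep M N f = rm_coords N \<circ> f \<circ> inv_into (rm_points M) (rm_coords M)"

text \<open>A smooth diffeomorphism that preserves the metric; the differential is computed on velocities
  of smooth curves.\<close>

definition riem_isometry ::
    "('p, 'e::euclidean_space) riem \<Rightarrow> ('q, 'f::euclidean_space) riem \<Rightarrow> ('p \<Rightarrow> 'q) \<Rightarrow> bool" where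
  "riem_isometry M N f \<longleftrightarrow>
     bij_betw f (rm_points M) (rm_points N) \<and>
     smooth_map_on (rm_coords M ` rm_points M) (coord_rep M N f) \<and>
     smooth_map_on (rm_coords N ` rm_points N) (coord_rep N M (inv_into (rm_points M) f)) \<and>
     (\<forall>p\<in>rm_points M. \<forall>c c'.
        smooth_curve_in (rm_coords M ` rm_points M) c \<and> c 0 = rm_coords M p \<and>
        smooth_curve_in (rm_coords M ` rm_points M) c' \<and> c' 0 = rm_coords M p \<longrightarrow>
        rm_metric N (f p)
          (vector_derivative (coord_rep M N f \<circ> c) (at 0))
          (vector_derivative (coord_rep M N f \<circ> c') (at 0)) =
        rm_metric M p (vector_derivative c (at 0)) (vector_derivative c' (at 0)))"

definition riem_isometric ::
    "('p, 'e::euclidean_space) riem \<Rightarrow> ('q, 'f::euclidean_space) riem \<Rightarrow> bool" where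
  "riem_isometric M N \<longleftrightarrow> (\<exists>f. riem_isometry M N f)"

definition remove_point :: "('p, 'e) riem \<Rightarrow> 'p \<Rightarrow> ('p, 'e) riem" where
  "remove_point M p = M\<lparr>rm_points := rm_points M - {p}\<rparr>"

text \<open>The metric induced on an open set \<open>S\<close> of parameters by a (smooth, immersive) parametrization
  \<open>\<iota>\<close> with values in \<open>M\<close>.\<close>

definition induced_riem ::
    "'a::euclidean_space set \<Rightarrow> ('a \<Rightarrow> 'p) \<Rightarrow> ('p, 'e::euclidean_space) riem \<Rightarrow> ('a, 'a) riem" where
  "induced_riem S \<iota> M =
     \<lparr>rm_points = S, rm_coords = (\<lambda>x. x),
      rm_metric = (\<lambda>x v w. rm_metric M (\<iota> x)
        (frechet_derivative (rm_coords M \<circ> \<iota>) (at x) v)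
        (frechet_derivative (rm_coords M \<circ> \<iota>) (at x) w))\<rparr>"

definition unit_sphere :: "(real^'k, real^'k) riem" where
  "unit_sphere = \<lparr>rm_points = sphere 0 1, rm_coords = (\<lambda>x. x), rm_metric = (\<lambda>_ v w. v \<bullet> w)\<rparr>"

definition warped_product ::
    "('b, 'e) riem \<Rightarrow> ('b \<Rightarrow> real) \<Rightarrow> ('q, 'f) riem \<Rightarrow> ('b \<times> 'q, 'e \<times> 'f) riem" where
  "warped_product B \<phi> F =
     \<lparr>rm_points = rm_points B \<times> rm_points F,
      rm_coords = map_prod (rm_coords B) (rm_coords F),
      rm_metric = (\<lambda>(b, q) (v, \<xi>) (w, \<eta>).
        rm_metric B b v w + exp (2 * \<phi> b) * rm_metric F q \<xi> \<eta>)\<rparr>"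

section \<open>The group \<open>SO\<^sub>0(n,1)\<close>\<close>

text \<open>If \<open>'k\<close> indexes \<open>1, \<dots>, m\<close>, then \<open>'k suc_idx\<close> indexes \<open>1, \<dots>, m + 1\<close>, with \<open>Last\<close> in the role
  of \<open>m + 1\<close>. Throughout, \<open>'m\<close> indexes \<open>1, \<dots>, n - 1\<close>; since types are nonempty, \<open>n \<ge> 2\<close>. Thus
  \<open>\<real>\<^sup>n\<close> is \<open>'m rvec\<close>, the index \<open>n\<close> of \<open>1, \<dots>, n + 1\<close> is \<open>Idx Last\<close>, and \<open>n + 1\<close> is
  \<open>Last\<close>.\<close>

datatype 'k suc_idx = Idx 'k | Last

instance suc_idx :: (finite) finite
proof
  have "(UNIV :: 'a suc_idx set) = insert Last (range Idx)"
    by (auto intro: suc_idx.exhaust)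
  moreover have "finite (insert Last (range (Idx :: 'a \<Rightarrow> 'a suc_idx)))"
    by (intro finite.insertI finite_imageI finite)
  ultimately show "finite (UNIV :: 'a suc_idx set)"
    by metis
qed

instantiation suc_idx :: (linorder) linorder
begin

definition less_eq_suc_idx :: "'a suc_idx \<Rightarrow> 'a suc_idx \<Rightarrow> bool" where
  "i \<le> j \<longleftrightarrow> (case j of Last \<Rightarrow> True | Idx b \<Rightarrow> (case i of Last \<Rightarrow> False | Idx a \<Rightarrow> a \<le> b))"

definition less_suc_idx :: "'a suc_idx \<Rightarrow> 'a suc_idx \<Rightarrow> bool" where
  "i < j \<longleftrightarrow> (case i of Last \<Rightarrow> False | Idx a \<Rightarrow> (case j of Last \<Rightarrow> True | Idx b \<Rightarrow> a < b))"

instance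
  by standard (auto simp: less_eq_suc_idx_def less_suc_idx_def split: suc_idx.splits)

end

type_synonym 'm idx = "'m suc_idx suc_idx"
type_synonym 'm rvec = "(real, 'm suc_idx) vec"
type_synonym 'm rmat = "((real, 'm suc_idx) vec, 'm suc_idx) vec"
type_synonym 'm mat = "((real, 'm suc_idx suc_idx) vec, 'm suc_idx suc_idx) vec"

text \<open>Coordinates \<open>(x, y)\<close> on the quotient, in \<open>\<real>\<^sup>n\<^sup>-\<^sup>1 \<times> \<real>\<close>.\<close>

type_synonym 'm hcoord = "(real, 'm) vec \<times> real"

definition Jmat :: "'m::{finite,linorder} mat" where
  "Jmat = (\<chi> i j. if i = j then (if i = Last then 1 else -1) else 0)"

definition pseudo_orthogonal :: "'m::{finite,linorder} mat set" where
  "pseudo_orthogonal = {A. invertible A \<and> A ** Jmat ** transpose A = Jmat}"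

definition SO0 :: "'m::{finite,linorder} mat set" where
  "SO0 = connected_component_set pseudo_orthogonal (mat 1)"

definition block_diag_1 :: "'m::{finite,linorder} rmat \<Rightarrow> 'm mat" where
  "block_diag_1 B = (\<chi> i j. case (i, j) of (Idx a, Idx b) \<Rightarrow> B $ a $ b
     | (Last, Last) \<Rightarrow> 1 | _ \<Rightarrow> 0)"

definition Kgrp :: "'m::{finite,linorder} mat set" where
  "Kgrp = block_diag_1 ` {B. rotation_matrix B}"

definition elem_mat :: "'m::{finite,linorder} idx \<Rightarrow> 'm idx \<Rightarrow> 'm mat" where
  "elem_mat i j = (\<chi> a b. if a = i \<and> b = j then 1 else 0)"

definition Emat :: "'m::{finite,linorder} idx \<Rightarrow> 'm idx \<Rightarrow> 'm mat" where
  "Emat i j = (if j = Last then 1 else -1) *\<^sub>R elem_mat i j + elem_mat j i"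

definition Eframe :: "'m::{finite,linorder} mat set" where
  "Eframe = {Emat i j | i j. i < j}"

text \<open>The inner product on the span of the linearly independent set \<open>Eframe\<close> for which \<open>Eframe\<close> is
  orthonormal; the span is the Lie algebra.\<close>

definition ip_id :: "'m::{finite,linorder} mat \<Rightarrow> 'm mat \<Rightarrow> real" where
  "ip_id X Y = (\<Sum>b\<in>Eframe. representation Eframe X b * representation Eframe Y b)"

text \<open>Left-invariant metric on tangent vectors \<open>u\<close>, \<open>w\<close> at \<open>g\<close>: left translation by the inverse of \<open>g\<close>
  is the restriction of a linear map, hence is its own differential.\<close>

definition metric_G :: "'m::{finite,linorder} mat \<Rightarrow> 'm mat \<Rightarrow> 'm mat \<Rightarrow> real" where
  "metric_G g u w = ip_id (matrix_inv g ** u) (matrix_inv g ** w)"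

section \<open>The quotient of \<open>SO\<^sub>0(n,1)\<close> by left multiplication by \<open>SO(n)\<close>\<close>

definition orbit :: "'m::{finite,linorder} mat \<Rightarrow> 'm mat set" where
  "orbit g = {k ** g | k. k \<in> Kgrp}"

text \<open>The exponential is defined by hand because multiplication of the type \<open>real^'n^'n\<close>, and with
  it \<open>exp\<close> and powers, is componentwise.\<close>

definition mat_exp :: "real^'n^'n \<Rightarrow> real^'n^'n" where
  "mat_exp A = (\<Sum>k. (1 / fact k) *\<^sub>R (((**) A ^^ k) (mat 1)))"

definition Nmat :: "'m::{finite,linorder} \<Rightarrow> 'm mat" where
  "Nmat i = Emat (Idx (Idx i)) (Idx Last) + Emat (Idx (Idx i)) Last"

definition Amat :: "'m::{finite,linorder} mat" where
  "Amat = Emat (Idx Last) Last"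

definition lift_point :: "'m::{finite,linorder} hcoord \<Rightarrow> 'm mat" where
  "lift_point = (\<lambda>(x, y). mat_exp (\<Sum>i\<in>UNIV. (x $ i) *\<^sub>R Nmat i) ** mat_exp (ln y *\<^sub>R Amat))"

definition hyp_point :: "'m::{finite,linorder} hcoord \<Rightarrow> 'm mat set" where
  "hyp_point p = orbit (lift_point p)"

definition hyp_coords :: "'m::{finite,linorder} mat set \<Rightarrow> 'm hcoord" where
  "hyp_coords = inv_into (UNIV \<times> {0<..}) hyp_point"

text \<open>The vertical space at \<open>g\<close> is the tangent space of the fibre \<open>orbit g\<close> through \<open>g\<close>.\<close>

definition horizontal_space :: "'m::{finite,linorder} mat \<Rightarrow> 'm mat set" where
  "horizontal_space g =
     {u \<in> tangent_space SO0 g. \<forall>w\<in>tangent_space (orbit g) g. metric_G g u w = 0}"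

text \<open>\<open>dproj g u v\<close>: the differential at \<open>g\<close> of the projection, in the global coordinates, sends the
  tangent vector \<open>u\<close> to \<open>v\<close>.\<close>

definition dproj :: "'m::{finite,linorder} mat \<Rightarrow> 'm mat \<Rightarrow> 'm hcoord \<Rightarrow> bool" where
  "dproj g u v \<longleftrightarrow>
     (\<exists>c. smooth_curve_in SO0 c \<and> c 0 = g \<and> (c has_vector_derivative u) (at 0) \<and>
          ((\<lambda>t. hyp_coords (orbit (c t))) has_vector_derivative v) (at 0))"

text \<open>The metric that makes the projection a Riemannian submersion: the value on \<open>v\<close>, \<open>w\<close> is the inner
  product of horizontal vectors over \<open>v\<close>, \<open>w\<close> at a common point of the fibre; by invariance under
  \<open>Kgrp\<close> it does not depend on that point.\<close>

definition hyp_metric ::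
    "'m::{finite,linorder} mat set \<Rightarrow> 'm hcoord \<Rightarrow> 'm hcoord \<Rightarrow> real" where
  "hyp_metric P v w = (THE r. \<exists>g\<in>SO0. \<exists>u\<in>horizontal_space g. \<exists>u'\<in>horizontal_space g.
     orbit g = P \<and> dproj g u v \<and> dproj g u' w \<and> r = metric_G g u u')"

definition hyp_space :: "('m::{finite,linorder} mat set, 'm hcoord) riem" where
  "hyp_space = \<lparr>rm_points = orbit ` SO0, rm_coords = hyp_coords, rm_metric = hyp_metric\<rparr>"

end

theory Submission
  imports Defs
begin

text \<open>
  Write \<open>J\<close> for \<open>Jmat\<close>, \<open>K\<close> for \<open>Kgrp\<close> and \<open>lor\<close> for the Lorentz form of \<open>J\<close>. Since \<open>K\<close> is the
  stabilizer of the last unit row vector, a coset \<open>K g\<close> is determined by the bottom row \<open>r\<close> of \<open>g\<close>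
  (\<open>orbit_eq\<close>). These rows fill the upper sheet \<open>lor r r = 1\<close> of the hyperboloid, and the global
  coordinates are a linear function of \<open>r\<close>: \<open>x\<close> consists of the first entries and \<open>y\<close> is the sum of
  the last two (\<open>hyp_coords_orbit\<close>).

  A tangent vector \<open>g X\<close> at \<open>g\<close>, with \<open>X\<close> in the Lie algebra, moves the bottom row by \<open>r X\<close>; it is
  vertical when \<open>r X = 0\<close>. The inner product on the Lie algebra is half of the Frobenius product
  (\<open>ip_id_lie_alg\<close>), so the horizontal vectors form the range of the adjoint of \<open>X \<mapsto> r X\<close>. This
  gives an explicit horizontal lift (\<open>hor_lift\<close>) of a vector \<open>\<rho>\<close> tangent to the hyperboloid, and its
  squared length is \<open>\<bar>\<rho>\<bar>\<^sup>2 / \<bar>r\<bar>\<^sup>2\<close>. The quotient metric is thus conformal to the Euclidean metric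
  that the hyperboloid inherits from its ambient space (\<open>hyp_metric_eq\<close>).

  In polar coordinates \<open>r = (sinh (ln t) e, cosh (ln t))\<close> with \<open>t > 1\<close> and \<open>\<bar>e\<bar> = 1\<close>, the Euclidean metric
  is \<open>cosh (2 ln t) dt\<^sup>2 / t\<^sup>2 + sinh\<^sup>2 (ln t) \<bar>de\<bar>\<^sup>2\<close>, and \<open>\<bar>r\<bar>\<^sup>2 = cosh (2 ln t)\<close>. Dividing the
  former by the latter gives the metric of the warped product (\<open>hyp_metric_polar\<close>). The polar coordinates cover everything except the vertex
  of the hyperboloid, which is the removed point.
\<close>

section \<open>Calculus of smooth maps\<close>

lemma Ck_on_cong:
  assumes "open S" "Ck_on k S f" "\<And>x. x \<in> S \<Longrightarrow> f x = g x"
  shows "Ck_on k S g"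
  using assms(2,3)
proof (induction k arbitrary: f g)
  case 0
  then show ?case by (simp cong: continuous_on_cong)
next
  case (Suc k)
  have D: "(g has_derivative frechet_derivative f (at x)) (at x)" if "x \<in> S" for x
  proof -
    have "(f has_derivative frechet_derivative f (at x)) (at x)"
      using Suc.prems(1) that by (simp add: frechet_derivative_works)
    then show ?thesis
      using has_derivative_transform_within_open[OF _ \<open>open S\<close> that] Suc.prems(2) by blast
  qed
  have eq: "frechet_derivative f (at x) = frechet_derivative g (at x)" if "x \<in> S" for x
    using D[OF that] frechet_derivative_at by blast
  have "Ck_on k S (\<lambda>x. frechet_derivative g (at x) v)" for v
  proof (rule Suc.IH)
    show "Ck_on k S (\<lambda>x. frechet_derivative f (at x) v)" using Suc.prems(1) by simp
  qed (simp add: eq)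
  then show ?case using D by (auto simp: differentiable_def)
qed

lemma Ck_on_SucI:
  assumes "open S" "\<And>x. x \<in> S \<Longrightarrow> (f has_derivative f' x) (at x)"
    and "\<And>v. Ck_on k S (\<lambda>x. f' x v)"
  shows "Ck_on (Suc k) S f"
proof -
  have "Ck_on k S (\<lambda>x. frechet_derivative f (at x) v)" for v
    by (rule Ck_on_cong[OF \<open>open S\<close> assms(3)[of v]]) (metis assms(2) frechet_derivative_at)
  then show ?thesis using assms(2) by (auto simp: differentiable_def)
qed

lemma Ck_on_Suc_has_derivative:
  assumes "Ck_on (Suc k) S f" "x \<in> S"
  shows "(f has_derivative frechet_derivative f (at x)) (at x)"
  using assms by (simp add: frechet_derivative_works)

text \<open>The recursive definition of \<open>Ck_on\<close> only asks for differentiability at the lower orders; this is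
  what makes a product rule, whose terms contain undifferentiated factors, usable in an induction.\<close>

lemma Ck_on_Suc_imp: "Ck_on (Suc k) S f \<Longrightarrow> Ck_on k S f"
proof (induction k arbitrary: f)
  case 0
  then have "f differentiable_on S"
    by (simp add: differentiable_at_imp_differentiable_on)
  then show ?case by (simp add: differentiable_imp_continuous_on)
next
  case (Suc k)
  show ?case unfolding Ck_on.simps(2)[of k]
    using Suc.prems Suc.IH unfolding Ck_on.simps(2)[of "Suc k"] by blast
qed

lemma Ck_on_const: "open S \<Longrightarrow> Ck_on k S (\<lambda>x. c)"
proof (induction k arbitrary: c)
  case (Suc k)
  show ?case
    by (rule Ck_on_SucI[OF Suc.prems, where f' = "\<lambda>x v. 0"]) (auto intro: Suc)
qed simp

lemma Ck_on_linear:
  assumes "bounded_linear f" "open S"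
  shows "Ck_on k S f"
proof (cases k)
  case 0
  then show ?thesis using assms by (simp add: linear_continuous_on)
next
  case (Suc m)
  show ?thesis unfolding Suc
    by (rule Ck_on_SucI[OF assms(2), where f' = "\<lambda>x. f"])
      (auto intro: Ck_on_const assms bounded_linear_imp_has_derivative)
qed

lemma Ck_on_add:
  assumes "open S" "Ck_on k S f" "Ck_on k S g"
  shows "Ck_on k S (\<lambda>x. f x + g x)"
  using assms(2,3)
proof (induction k arbitrary: f g)
  case 0
  then show ?case by (simp add: continuous_on_add)
next
  case (Suc k)
  show ?case
  proof (rule Ck_on_SucI[OF assms(1)])
    fix x assume "x \<in> S"
    then show "((\<lambda>x. f x + g x) has_derivative
        (\<lambda>v. frechet_derivative f (at x) v + frechet_derivative g (at x) v)) (at x)"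
      using Suc.prems by (auto intro!: has_derivative_add simp: frechet_derivative_works)
  next
    fix v
    show "Ck_on k S (\<lambda>x. frechet_derivative f (at x) v + frechet_derivative g (at x) v)"
      using Suc.prems by (auto intro!: Suc.IH)
  qed
qed

text \<open>By induction on the order: the product rule expresses each directional derivative through
  bilinear terms in maps of class one lower. Scalar multiples, inner products and matrix products
  are all instances.\<close>

lemma Ck_on_bilinear:
  fixes B :: "'b::euclidean_space \<Rightarrow> 'c::euclidean_space \<Rightarrow> 'd::euclidean_space"
  assumes B: "bounded_bilinear B" and "open S" "Ck_on k S f" "Ck_on k S g"
  shows "Ck_on k S (\<lambda>x. B (f x) (g x))"
  using assms(3,4)
proof (induction k arbitrary: f g)
  case 0
  then show ?case by (simp add: bounded_bilinear.continuous_on[OF B])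
next
  case (Suc k)
  show ?case
  proof (rule Ck_on_SucI[OF \<open>open S\<close>])
    fix x assume "x \<in> S"
    then show "((\<lambda>x. B (f x) (g x)) has_derivative
        (\<lambda>v. B (f x) (frechet_derivative g (at x) v) + B (frechet_derivative f (at x) v) (g x))) (at x)"
      using Suc.prems by (auto intro!: bounded_bilinear.FDERIV[OF B] simp: frechet_derivative_works)
  next
    fix v
    show "Ck_on k S (\<lambda>x. B (f x) (frechet_derivative g (at x) v) + B (frechet_derivative f (at x) v) (g x))"
      using Suc.prems Ck_on_Suc_imp[OF Suc.prems(1)] Ck_on_Suc_imp[OF Suc.prems(2)]
      by (auto intro!: Suc.IH Ck_on_add[OF \<open>open S\<close>])
  qed
qed

lemma Ck_on_linear_comp:
  assumes L: "bounded_linear L" and "open S" "Ck_on k S f"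
  shows "Ck_on k S (\<lambda>x. L (f x))"
  using assms(3)
proof (induction k arbitrary: f)
  case 0
  then show ?case by (simp add: bounded_linear.continuous_on[OF L])
next
  case (Suc k)
  show ?case
  proof (rule Ck_on_SucI[OF \<open>open S\<close>])
    fix x assume "x \<in> S"
    then show "((\<lambda>x. L (f x)) has_derivative (\<lambda>v. L (frechet_derivative f (at x) v))) (at x)"
      using Suc.prems by (auto intro!: bounded_linear.has_derivative[OF L] simp: frechet_derivative_works)
  next
    fix v
    show "Ck_on k S (\<lambda>x. L (frechet_derivative f (at x) v))"
      using Suc.prems by (auto intro!: Suc.IH)
  qed
qed

lemma Ck_on_Pair:
  assumes S: "open S" and f: "Ck_on k S f" and g: "Ck_on k S g"
  shows "Ck_on k S (\<lambda>x. (f x, g x))"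
proof -
  have "Ck_on k S (\<lambda>x. (f x, 0) + (0, g x))"
    by (intro Ck_on_add S Ck_on_linear_comp[OF _ S f] Ck_on_linear_comp[OF _ S g]
        bounded_linear_Pair bounded_linear_ident bounded_linear_zero)
  then show ?thesis by simp
qed

lemmas Ck_on_scaleR = Ck_on_bilinear[OF bounded_bilinear_scaleR]
lemmas Ck_on_inner = Ck_on_bilinear[OF bounded_bilinear_inner]
lemmas Ck_on_mult = Ck_on_bilinear[OF bounded_bilinear_mult[where 'a = real]]

text \<open>The derivative of \<open>1 / f\<close> is polynomial in \<open>1 / f\<close> and the derivative of \<open>f\<close>, so the class of
  \<open>1 / f\<close> can be raised one step at a time. The square root below works in the same way.\<close>

lemma Ck_on_inverse:
  fixes f :: "'a::euclidean_space \<Rightarrow> real"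
  assumes S: "open S" and f: "Ck_on k S f" and nz: "\<And>x. x \<in> S \<Longrightarrow> f x \<noteq> 0"
  shows "Ck_on k S (\<lambda>x. inverse (f x))"
  using f
proof (induction k)
  case 0
  then show ?case using nz by (auto intro: continuous_on_inverse)
next
  case (Suc k)
  show ?case
  proof (rule Ck_on_SucI[OF S])
    fix x assume "x \<in> S"
    then show "((\<lambda>x. inverse (f x)) has_derivative
        (\<lambda>v. - (inverse (f x) * frechet_derivative f (at x) v * inverse (f x)))) (at x)"
      using Suc.prems nz by (auto intro!: has_derivative_inverse simp: frechet_derivative_works)
  next
    fix v
    have "Ck_on k S (\<lambda>x. inverse (f x))" using Suc.IH Ck_on_Suc_imp[OF Suc.prems] .
    then show "Ck_on k S (\<lambda>x. - (inverse (f x) * frechet_derivative f (at x) v * inverse (f x)))"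
      using Suc.prems
      by (auto intro!: Ck_on_linear_comp[OF bounded_linear_minus[OF bounded_linear_ident] S] Ck_on_mult S)
  qed
qed

lemma Ck_on_sqrt:
  fixes f :: "'a::euclidean_space \<Rightarrow> real"
  assumes S: "open S" and f: "Ck_on k S f" and pos: "\<And>x. x \<in> S \<Longrightarrow> f x > 0"
  shows "Ck_on k S (\<lambda>x. sqrt (f x))"
  using f
proof (induction k)
  case 0
  then show ?case by (auto intro: continuous_on_real_sqrt)
next
  case (Suc k)
  show ?case
  proof (rule Ck_on_SucI[OF S])
    fix x assume "x \<in> S"
    then show "((\<lambda>x. sqrt (f x)) has_derivative
        (\<lambda>v. (1/2) * (inverse (sqrt (f x)) * frechet_derivative f (at x) v))) (at x)"
      using Ck_on_Suc_has_derivative[OF Suc.prems] pos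
      by (auto intro!: derivative_eq_intros simp: field_simps)
  next
    fix v
    have "Ck_on k S (\<lambda>x. sqrt (f x))" using Suc.IH Ck_on_Suc_imp[OF Suc.prems] .
    moreover have "sqrt (f x) \<noteq> 0" if "x \<in> S" for x using pos[OF that] by simp
    ultimately show "Ck_on k S (\<lambda>x. (1/2) * (inverse (sqrt (f x)) * frechet_derivative f (at x) v))"
      using Suc.prems by (intro Ck_on_mult S Ck_on_inverse Ck_on_const) auto
  qed
qed

lemma Ck_on_norm:
  fixes f :: "'a::euclidean_space \<Rightarrow> 'b::euclidean_space"
  assumes S: "open S" and f: "Ck_on k S f" and nz: "\<And>x. x \<in> S \<Longrightarrow> f x \<noteq> 0"
  shows "Ck_on k S (\<lambda>x. norm (f x))"
  unfolding norm_eq_sqrt_inner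
  using nz by (intro Ck_on_sqrt Ck_on_inner S f) auto

lemma Ck_on_trig:
  assumes S: "open S"
  shows "Ck_on k S (\<lambda>t::real. cos (a * t))" "Ck_on k S (\<lambda>t::real. sin (a * t))"
proof (induction k)
  case (Suc k)
  { case 1
    show ?case
    proof (rule Ck_on_SucI[OF S])
      show "((\<lambda>t. cos (a * t)) has_derivative (\<lambda>v. (- a * v) * sin (a * x))) (at x)" for x
        by (auto intro!: derivative_eq_intros)
    qed (intro Ck_on_mult S Ck_on_const Suc)
  next
    case 2
    show ?case
    proof (rule Ck_on_SucI[OF S])
      show "((\<lambda>t. sin (a * t)) has_derivative (\<lambda>v. (a * v) * cos (a * x))) (at x)" for x
        by (auto intro!: derivative_eq_intros)
    qed (intro Ck_on_mult S Ck_on_const Suc) }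
qed (auto intro!: continuous_intros)

lemma Ck_on_hyperbolic:
  assumes S: "open S"
  shows "Ck_on k S (\<lambda>t::real. cosh (a * t))" "Ck_on k S (\<lambda>t::real. sinh (a * t))"
proof (induction k)
  case (Suc k)
  { case 1
    show ?case
    proof (rule Ck_on_SucI[OF S])
      show "((\<lambda>t. cosh (a * t)) has_derivative (\<lambda>v. (a * v) * sinh (a * x))) (at x)" for x
        by (auto intro!: derivative_eq_intros)
    qed (intro Ck_on_mult S Ck_on_const Suc)
  next
    case 2
    show ?case
    proof (rule Ck_on_SucI[OF S])
      show "((\<lambda>t. sinh (a * t)) has_derivative (\<lambda>v. (a * v) * cosh (a * x))) (at x)" for x
        by (auto intro!: derivative_eq_intros)
    qed (intro Ck_on_mult S Ck_on_const Suc) }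
qed (auto intro!: continuous_intros)

lemma smooth_curve_inE:
  assumes "smooth_curve_in S c"
  obtains e where "e > 0" "\<And>k. Ck_on k {-e<..<e} c" "\<And>t. t \<in> {-e<..<e} \<Longrightarrow> c t \<in> S"
  using assms unfolding smooth_curve_in_def smooth_on_open_def by blast

lemma smooth_curve_in_vector_derivative:
  assumes "smooth_curve_in S c"
  shows "(c has_vector_derivative vector_derivative c (at 0)) (at 0)"
proof -
  obtain e where "e > 0" "Ck_on (Suc 0) {-e<..<e} c"
    using assms by (metis smooth_curve_inE)
  then have "c differentiable (at 0)" by simp
  then show ?thesis by (simp add: vector_derivative_works)
qed

section \<open>Indices, vectors and determinants with one added index\<close>

lemma UNIV_suc_idx: "(UNIV :: 'k suc_idx set) = insert Last (range Idx)"
  by (auto intro: suc_idx.exhaust)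

lemma inj_Idx: "inj Idx"
  by (simp add: inj_def)

lemma sum_suc_idx:
  fixes f :: "'k::finite suc_idx \<Rightarrow> 'b::comm_monoid_add"
  shows "(\<Sum>i\<in>UNIV. f i) = (\<Sum>i\<in>UNIV. f (Idx i)) + f Last"
proof -
  have "(\<Sum>i\<in>UNIV. f i) = f Last + (\<Sum>i\<in>range Idx. f i)"
    unfolding UNIV_suc_idx by (subst sum.insert) auto
  also have "(\<Sum>i\<in>range Idx. f i) = (\<Sum>i\<in>UNIV. f (Idx i))"
    by (simp add: sum.reindex[OF inj_Idx])
  finally show ?thesis by (simp add: add.commute)
qed

lemma prod_suc_idx:
  fixes f :: "'k::finite suc_idx \<Rightarrow> 'b::comm_monoid_mult"
  shows "(\<Prod>i\<in>UNIV. f i) = (\<Prod>i\<in>UNIV. f (Idx i)) * f Last"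
proof -
  have "(\<Prod>i\<in>UNIV. f i) = f Last * (\<Prod>i\<in>range Idx. f i)"
    unfolding UNIV_suc_idx by (subst prod.insert) auto
  also have "(\<Prod>i\<in>range Idx. f i) = (\<Prod>i\<in>UNIV. f (Idx i))"
    by (simp add: prod.reindex[OF inj_Idx])
  finally show ?thesis by (simp add: mult.commute)
qed

lemma all_suc_idx: "(\<forall>i. P i) \<longleftrightarrow> (\<forall>a. P (Idx a)) \<and> P Last"
  by (metis suc_idx.exhaust)

lemma less_suc_idx_simps [simp]:
  "Idx a < Idx b \<longleftrightarrow> a < b" "Idx a < Last" "\<not> Last < i"
  by (auto simp: less_suc_idx_def split: suc_idx.splits)

text \<open>The vector \<open>x\<close> followed by one more entry \<open>a\<close>. Points of Minkowski space are handled as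
  \<open>vsnoc (vsnoc x a) b\<close>, with \<open>b\<close> the time coordinate.\<close>

definition vsnoc :: "real^'k \<Rightarrow> real \<Rightarrow> real^('k::finite suc_idx)" where
  "vsnoc x a = (\<chi> i. case i of Idx j \<Rightarrow> x $ j | Last \<Rightarrow> a)"

definition vinit :: "real^('k::finite suc_idx) \<Rightarrow> real^'k" where
  "vinit r = (\<chi> j. r $ Idx j)"

lemma vsnoc_nth [simp]: "vsnoc x a $ Idx j = x $ j" "vsnoc x a $ Last = a"
  by (simp_all add: vsnoc_def)

lemma vinit_nth [simp]: "vinit r $ j = r $ Idx j"
  by (simp add: vinit_def)

lemma vinit_vsnoc [simp]: "vinit (vsnoc x a) = x"
  by (simp add: vec_eq_iff)

lemma vsnoc_vinit [simp]: "vsnoc (vinit r) (r $ Last) = r"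
  by (simp add: vec_eq_iff all_suc_idx)

lemma vsnoc_eq_iff [simp]: "vsnoc x a = vsnoc y b \<longleftrightarrow> x = y \<and> a = b"
  by (auto simp: vec_eq_iff all_suc_idx)

lemma inner_suc_idx: "u \<bullet> v = vinit u \<bullet> vinit v + u $ Last * v $ Last"
  for u v :: "real^('k::finite suc_idx)"
  by (simp add: inner_vec_def sum_suc_idx)

lemma inner_vsnoc [simp]: "vsnoc x a \<bullet> vsnoc y b = x \<bullet> y + a * b"
  by (simp add: inner_suc_idx)

lemma bounded_linear_vinit: "bounded_linear (vinit :: real^('k::finite suc_idx) \<Rightarrow> _)"
  by (rule linear_conv_bounded_linear[THEN iffD1], rule linearI) (simp_all add: vec_eq_iff)

lemma bounded_linear_vsnoc: "bounded_linear (\<lambda>p. vsnoc (fst p) (snd p) :: real^('k::finite suc_idx))"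
  by (rule linear_conv_bounded_linear[THEN iffD1], rule linearI) (simp_all add: vec_eq_iff all_suc_idx)

text \<open>Only the permutations that fix \<open>Last\<close> contribute to the Leibniz formula, and these correspond to
  the permutations of the smaller index set with the same sign.\<close>

lemma det_border:
  fixes M :: "real^('k::finite suc_idx)^('k suc_idx)" and B :: "real^'k^'k"
  assumes B: "\<And>i j. M $ Idx i $ Idx j = B $ i $ j"
    and Last0: "\<And>j. M $ Last $ Idx j = 0" "M $ Last $ Last = 1"
  shows "det M = det B"
proof -
  let ?t = "\<lambda>p. of_int (sign p) * (\<Prod>i\<in>UNIV. M $ i $ p i)"
  let ?P = "{p. p permutes (UNIV :: 'k suc_idx set)}"
  let ?Q = "{p. p permutes range (Idx :: 'k \<Rightarrow> _)}"
  have bij: "bij_betw Idx UNIV (range (Idx :: 'k \<Rightarrow> _))"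
    by (simp add: bij_betw_def inj_Idx)
  have "det M = sum ?t ?P" by (simp add: det_def)
  also have "\<dots> = sum ?t ?Q"
  proof (rule sum.mono_neutral_right)
    show "finite ?P" by (rule finite_permutations) simp
    show "?Q \<subseteq> ?P" by (auto intro: permutes_subset)
    show "\<forall>p\<in>?P - ?Q. ?t p = 0"
    proof
      fix p assume p: "p \<in> ?P - ?Q"
      \<comment> \<open>the factor in row \<open>Last\<close> vanishes unless \<open>p\<close> fixes \<open>Last\<close>\<close>
      have "p Last \<noteq> Last"
      proof
        assume "p Last = Last"
        then have "\<And>x. x \<in> UNIV - range Idx \<Longrightarrow> p x = x"
          by (metis DiffE UNIV_suc_idx insertE)
        then have "p permutes range Idx"
          using p permutes_superset[of p UNIV "range Idx"] by simp
        then show False using p by simp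
      qed
      then obtain j where "p Last = Idx j" by (cases "p Last") auto
      then have "(\<Prod>i\<in>UNIV. M $ i $ p i) = 0"
        by (simp add: prod_suc_idx Last0)
      then show "?t p = 0" by simp
    qed
  qed
  also have "\<dots> = (\<Sum>p\<in>{p. p permutes (UNIV :: 'k set)}. of_int (sign p) * (\<Prod>i\<in>UNIV. B $ i $ p i))"
  proof (rule sum.reindex_bij_witness[symmetric,
        where i = "map_permutation (range Idx) (inv Idx)" and j = "map_permutation UNIV Idx"])
    fix p :: "'k \<Rightarrow> 'k" assume "p \<in> {p. p permutes UNIV}"
    then have p: "p permutes UNIV" by simp
    show "map_permutation (range Idx) (inv Idx) (map_permutation UNIV Idx p) = p"
      by (rule map_permutation_compose_inv[OF bij p]) (simp add: inj_Idx)
    show q: "map_permutation UNIV Idx p \<in> ?Q"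
      using map_permutation_permutes[OF bij p] by simp
    have "sign (map_permutation UNIV Idx p) = sign p"
      by (rule sign_map_permutation) (auto simp: p inj_Idx)
    moreover have "map_permutation UNIV Idx p (Idx i) = Idx (p i)" for i
      by (rule map_permutation_apply) (auto simp: inj_Idx)
    moreover have "map_permutation UNIV Idx p Last = Last"
      using q by (auto simp: permutes_def)
    ultimately show "?t (map_permutation UNIV Idx p) = of_int (sign p) * (\<Prod>i\<in>UNIV. B $ i $ p i)"
      by (simp add: prod_suc_idx B Last0)
  next
    fix q :: "'k suc_idx \<Rightarrow> 'k suc_idx" assume "q \<in> ?Q"
    then have q: "q permutes range Idx" by simp
    have bij': "bij_betw (inv Idx) (range (Idx :: 'k \<Rightarrow> _)) UNIV"
      using bij bij_betw_inv_into by blast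
    show "map_permutation UNIV Idx (map_permutation (range Idx) (inv Idx) q) = q"
      by (rule map_permutation_compose_inv[OF bij' q]) (auto simp: inj_Idx)
    show "map_permutation (range Idx) (inv Idx) q \<in> {p. p permutes (UNIV :: 'k set)}"
      using map_permutation_permutes[OF bij' q] by simp
  qed
  finally show ?thesis by (simp add: det_def)
qed

section \<open>The Lorentz form and the pseudo-orthogonal group\<close>

text \<open>The diagonal of \<open>Jmat\<close>.\<close>

definition sig :: "'k suc_idx \<Rightarrow> real" where
  "sig i = (if i = Last then 1 else -1)"

lemma sig_simps [simp]: "sig Last = 1" "sig (Idx a) = -1" "sig i * sig i = 1"
  by (simp_all add: sig_def)

definition lor :: "real^('k::finite suc_idx) \<Rightarrow> real^('k suc_idx) \<Rightarrow> real" where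
  "lor u v = u $ Last * v $ Last - vinit u \<bullet> vinit v"

lemma lor_vsnoc [simp]: "lor (vsnoc x a) (vsnoc y b) = a * b - x \<bullet> y"
  by (simp add: lor_def)

lemma lor_sum: "lor u v = (\<Sum>i\<in>UNIV. u $ i * sig i * v $ i)"
  by (simp add: lor_def sum_suc_idx inner_vec_def sum_negf)

lemma lor_commute: "lor u v = lor v u"
  by (simp add: lor_def inner_commute mult.commute)

lemma bounded_bilinear_lor: "bounded_bilinear (lor :: real^('k::finite suc_idx) \<Rightarrow> _)"
  unfolding bilinear_conv_bounded_bilinear[symmetric] bilinear_def linear_iff lor_sum
  by (auto simp: algebra_simps sum.distrib sum_distrib_left)

lemma Jmat_nth: "Jmat $ i $ j = (if i = j then sig i else 0)"
  by (simp add: Jmat_def sig_def)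

lemma Jmat_mult_left [simp]: "(Jmat ** A) $ i $ j = sig i * A $ i $ j"
  by (simp add: matrix_matrix_mult_def Jmat_nth if_distrib if_distribR cong: if_cong)

lemma Jmat_mult_right [simp]: "(A ** Jmat) $ i $ j = A $ i $ j * sig j"
  by (simp add: matrix_matrix_mult_def Jmat_nth if_distrib if_distribR cong: if_cong)

lemma Jmat_Jmat: "Jmat ** Jmat = mat 1"
  by (simp add: vec_eq_iff Jmat_nth mat_def)

lemma transpose_Jmat: "transpose Jmat = Jmat"
  by (simp add: vec_eq_iff transpose_def Jmat_nth)

lemma Jmat_conj_nth: "(A ** Jmat ** transpose A) $ i $ j = lor (A $ i) (A $ j)"
proof -
  have "(A ** Jmat ** transpose A) $ i $ j = (\<Sum>k\<in>UNIV. (A ** Jmat) $ i $ k * A $ j $ k)"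
    unfolding matrix_matrix_mult_def[of "A ** Jmat"] by (simp add: transpose_def)
  then show ?thesis by (simp add: lor_sum)
qed

lemma mult_row: "(A ** B) $ i = A $ i v* B"
  by (simp add: vec_eq_iff matrix_matrix_mult_def vector_matrix_mult_def mult.commute)

lemma axis_vector_matrix: "axis i 1 v* A = A $ i" for A :: "real^'n^'m"
  by (simp add: vec_eq_iff vector_matrix_mult_def axis_def if_distrib if_distribR cong: if_cong)

lemma pseudo_orthogonal_right_inverse:
  assumes "A ** Jmat ** transpose A = Jmat"
  shows "A ** (Jmat ** transpose A ** Jmat) = mat 1"
proof -
  have "A ** (Jmat ** transpose A ** Jmat) = (A ** Jmat ** transpose A) ** Jmat"
    by (simp add: matrix_mul_assoc)
  then show ?thesis by (simp add: assms Jmat_Jmat)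
qed

lemma pseudo_orthogonal_iff: "A \<in> pseudo_orthogonal \<longleftrightarrow> A ** Jmat ** transpose A = Jmat"
  unfolding pseudo_orthogonal_def
  using pseudo_orthogonal_right_inverse[of A] by (auto simp: invertible_right_inverse)

text \<open>Membership in the group says that the rows form a Lorentz orthonormal basis.\<close>

lemma pseudo_orthogonal_iff_lor:
  "A \<in> pseudo_orthogonal \<longleftrightarrow> (\<forall>i j. lor (A $ i) (A $ j) = (if i = j then sig i else 0))"
  unfolding pseudo_orthogonal_iff vec_eq_iff by (simp add: Jmat_conj_nth Jmat_nth)

lemma pseudo_orthogonal_inverse:
  assumes "A \<in> pseudo_orthogonal"
  shows "matrix_inv A = Jmat ** transpose A ** Jmat"
    "A ** matrix_inv A = mat 1" "matrix_inv A ** A = mat 1"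
proof -
  let ?B = "Jmat ** transpose A ** Jmat"
  have r: "A ** ?B = mat 1"
    using assms pseudo_orthogonal_iff pseudo_orthogonal_right_inverse by blast
  then have l: "?B ** A = mat 1" by (simp add: matrix_left_right_inverse)
  have inv: "A ** matrix_inv A = mat 1 \<and> matrix_inv A ** A = mat 1"
    unfolding matrix_inv_def by (rule someI[of _ ?B]) (simp add: r l)
  then show "A ** matrix_inv A = mat 1" "matrix_inv A ** A = mat 1" by auto
  have "matrix_inv A = ?B ** A ** matrix_inv A" by (simp add: l)
  also have "\<dots> = ?B" using inv by (metis matrix_mul_assoc matrix_mul_rid)
  finally show "matrix_inv A = ?B" .
qed

lemma pseudo_orthogonal_mult:
  assumes "A \<in> pseudo_orthogonal" "B \<in> pseudo_orthogonal"
  shows "A ** B \<in> pseudo_orthogonal"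
proof -
  have "(A ** B) ** Jmat ** transpose (A ** B) = A ** (B ** Jmat ** transpose B) ** transpose A"
    by (simp add: matrix_transpose_mul matrix_mul_assoc)
  then show ?thesis using assms by (simp add: pseudo_orthogonal_iff)
qed

lemma pseudo_orthogonal_matrix_inv:
  assumes "A \<in> pseudo_orthogonal"
  shows "matrix_inv A \<in> pseudo_orthogonal"
proof -
  let ?B = "matrix_inv A"
  have "?B ** Jmat ** transpose ?B = ?B ** (A ** Jmat ** transpose A) ** transpose ?B"
    using assms by (simp add: pseudo_orthogonal_iff)
  also have "\<dots> = (?B ** A) ** Jmat ** transpose (?B ** A)"
    by (simp add: matrix_transpose_mul matrix_mul_assoc)
  finally show ?thesis
    by (simp add: pseudo_orthogonal_inverse(3)[OF assms] pseudo_orthogonal_iff)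
qed

lemma mat_1_pseudo_orthogonal: "mat 1 \<in> pseudo_orthogonal"
  by (simp add: pseudo_orthogonal_iff)

lemma det_square_pseudo_orthogonal:
  assumes "A \<in> pseudo_orthogonal"
  shows "(det A)\<^sup>2 = 1"
proof -
  have "det (Jmat :: 'a mat) * det (Jmat :: 'a mat) = 1"
    by (metis det_mul Jmat_Jmat det_I)
  then have nz: "det (Jmat :: 'a mat) \<noteq> 0" by auto
  have "det A * det (Jmat :: 'a mat) * det A = det (Jmat :: 'a mat)"
    using arg_cong[OF assms[unfolded pseudo_orthogonal_iff], of det] by (simp only: det_mul det_transpose)
  then have "(det A)\<^sup>2 * det (Jmat :: 'a mat) = 1 * det (Jmat :: 'a mat)"
    by (simp add: power2_eq_square mult_ac)
  then show ?thesis using nz by simp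
qed

lemma continuous_on_det: "continuous_on S (det :: real^'n^'n \<Rightarrow> real)"
  unfolding det_def by (intro continuous_intros)

section \<open>The identity component and its orbits\<close>

lemma SO0_subset: "SO0 \<subseteq> pseudo_orthogonal"
  unfolding SO0_def by (rule connected_component_subset)

text \<open>Applied below to left translates of the component and to the families of rotations, boosts and
  exponentials that pass through the identity.\<close>

lemma SO0_connected_subset:
  assumes "connected S" "S \<subseteq> pseudo_orthogonal" "a \<in> S" "a \<in> SO0"
  shows "S \<subseteq> SO0"
  using connected_component_maximal[OF assms(3,1,2)] assms(4)
  unfolding SO0_def by (metis connected_component_eq)

lemma mat_1_SO0: "mat 1 \<in> SO0"
  unfolding SO0_def using mat_1_pseudo_orthogonal by (simp add: connected_component_refl_eq)

lemma bounded_bilinear_matrix_mult: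
  "bounded_bilinear ((**) :: real^'n^'m \<Rightarrow> real^'k^'n \<Rightarrow> real^'k^'m)"
  unfolding bilinear_conv_bounded_bilinear[symmetric] bilinear_def linear_iff
  by (auto simp: vec_eq_iff matrix_matrix_mult_def algebra_simps sum.distrib sum_distrib_left)

lemma continuous_on_matrix_mult [continuous_intros]:
  fixes f :: "_ \<Rightarrow> real^'n^'m" and g :: "_ \<Rightarrow> real^'k^'n"
  assumes "continuous_on S f" "continuous_on S g"
  shows "continuous_on S (\<lambda>x. f x ** g x)"
  using bounded_bilinear.continuous_on[OF bounded_bilinear_matrix_mult assms] .

lemma SO0_mult:
  assumes "A \<in> SO0" "B \<in> SO0"
  shows "A ** B \<in> SO0"
proof -
  have "(\<lambda>X. A ** X) ` SO0 \<subseteq> SO0"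
  proof (rule SO0_connected_subset[where a = A])
    show "connected ((\<lambda>X. A ** X) ` SO0)"
      by (intro connected_continuous_image continuous_intros) (simp add: SO0_def)
    show "(\<lambda>X. A ** X) ` SO0 \<subseteq> pseudo_orthogonal"
      using SO0_subset assms(1) pseudo_orthogonal_mult by blast
    show "A \<in> (\<lambda>X. A ** X) ` SO0"
      by (rule image_eqI[of _ _ "mat 1"]) (simp_all add: mat_1_SO0)
  qed (fact assms)
  then show ?thesis using assms(2) by blast
qed

lemma connected_no_zero_pos:
  fixes f :: "'a::topological_space \<Rightarrow> real"
  assumes "connected S" "continuous_on S f" "\<And>x. x \<in> S \<Longrightarrow> f x \<noteq> 0" "a \<in> S" "f a > 0" "x \<in> S"
  shows "f x > 0"
proof (rule ccontr)
  assume "\<not> f x > 0"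
  then have "0 \<in> f ` S"
    using connectedD_interval[OF connected_continuous_image[OF assms(2,1)], of "f x" "f a" 0] assms
    by auto
  then show False using assms(3) by auto
qed

lemma det_SO0:
  assumes "A \<in> SO0"
  shows "det A = 1"
proof -
  have "det A > 0"
  proof (rule connected_no_zero_pos[where S = SO0 and a = "mat 1"])
    show "connected (SO0 :: 'a mat set)" by (simp add: SO0_def)
    show "det X \<noteq> 0" if "X \<in> SO0" for X :: "'a mat"
      using that SO0_subset det_square_pseudo_orthogonal[of X] by auto
  qed (auto simp: assms mat_1_SO0 continuous_on_det)
  moreover have "(det A)\<^sup>2 = 1"
    using assms SO0_subset det_square_pseudo_orthogonal by blast
  ultimately show ?thesis by (auto simp: power2_eq_1_iff)
qed

lemma lor_self_row_Last:
  assumes "A \<in> pseudo_orthogonal"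
  shows "lor (A $ Last) (A $ Last) = 1"
  using assms by (simp add: pseudo_orthogonal_iff_lor)

text \<open>The bottom row \<open>r\<close> satisfies \<open>lor r r = 1\<close>, so its last entry never vanishes and keeps
  the sign that it has at the identity: bottom rows lie on the upper sheet of the hyperboloid.\<close>

lemma SO0_Last_Last:
  assumes "A \<in> SO0"
  shows "A $ Last $ Last > 0"
proof (rule connected_no_zero_pos[where S = SO0 and a = "mat 1" and f = "\<lambda>X. X $ Last $ Last"])
  show "connected (SO0 :: 'a mat set)" by (simp add: SO0_def)
  show "X $ Last $ Last \<noteq> 0" if "X \<in> SO0" for X :: "'a mat"
  proof
    assume "X $ Last $ Last = 0"
    moreover have "lor (X $ Last) (X $ Last) = 1"
      using lor_self_row_Last that SO0_subset by blast
    ultimately show False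
      using inner_ge_zero[of "vinit (X $ Last)"] by (simp add: lor_def)
  qed
  show "(mat 1 :: 'a mat) $ Last $ Last > 0" by (simp add: mat_def)
qed (auto simp: assms mat_1_SO0 intro!: continuous_intros)

lemma block_diag_1_nth [simp]:
  "block_diag_1 B $ Idx a $ Idx b = B $ a $ b"
  "block_diag_1 B $ Idx a $ Last = 0"
  "block_diag_1 B $ Last $ Idx b = 0"
  "block_diag_1 B $ Last $ Last = 1"
  by (simp_all add: block_diag_1_def)

lemma block_diag_1_rows:
  "block_diag_1 B $ Idx a = vsnoc (B $ a) 0" "block_diag_1 B $ Last = vsnoc 0 1"
  by (simp_all add: vec_eq_iff all_suc_idx)

lemma axis_Last: "axis Last 1 = vsnoc 0 1"
  by (simp add: vec_eq_iff all_suc_idx axis_def)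

lemma orthogonal_matrix_iff_rows:
  "orthogonal_matrix B \<longleftrightarrow> (\<forall>a b. B $ a \<bullet> B $ b = (if a = b then 1 else 0))"
  for B :: "real^'k^'k"
proof -
  have "orthogonal_matrix B \<longleftrightarrow> B ** transpose B = mat 1"
    by (auto simp: orthogonal_matrix_def matrix_left_right_inverse)
  also have "\<dots> \<longleftrightarrow> (\<forall>a b. B $ a \<bullet> B $ b = (if a = b then 1 else 0))"
    by (simp add: vec_eq_iff matrix_matrix_mult_def transpose_def mat_def inner_vec_def)
  finally show ?thesis .
qed

lemma det_block_diag_1: "det (block_diag_1 B) = det B"
  by (rule det_border) auto

lemma block_diag_1_pseudo_orthogonal:
  "block_diag_1 B \<in> pseudo_orthogonal \<longleftrightarrow> orthogonal_matrix B"
proof -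
  have "(- x = (if P then - 1 else 0)) \<longleftrightarrow> x = (if P then 1 else 0)" for x :: real and P by auto
  then show ?thesis
    by (simp add: pseudo_orthogonal_iff_lor orthogonal_matrix_iff_rows all_suc_idx block_diag_1_rows)
qed

text \<open>The group \<open>Kgrp\<close> is the stabilizer of the last unit row vector. Orthogonality of a
  row to this vector forces the last column to be trivial as well, which gives the block form.\<close>

lemma Kgrp_iff:
  "k \<in> Kgrp \<longleftrightarrow> k \<in> pseudo_orthogonal \<and> det k = 1 \<and> k $ Last = axis Last 1"
proof
  assume "k \<in> Kgrp"
  then show "k \<in> pseudo_orthogonal \<and> det k = 1 \<and> k $ Last = axis Last 1"
    by (auto simp: Kgrp_def rotation_matrix_def block_diag_1_pseudo_orthogonal det_block_diag_1
        block_diag_1_rows axis_Last)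
next
  assume k: "k \<in> pseudo_orthogonal \<and> det k = 1 \<and> k $ Last = axis Last 1"
  define B :: "'a rmat" where "B = (\<chi> a b. k $ Idx a $ Idx b)"
  have "k $ Idx a $ Last = 0" for a
  proof -
    have "lor (k $ Idx a) (k $ Last) = (if Idx a = Last then sig (Idx a) else 0)"
      using k unfolding pseudo_orthogonal_iff_lor by blast
    then show ?thesis using k by (simp add: lor_def axis_Last)
  qed
  then have eq: "k = block_diag_1 B"
    using k by (simp add: vec_eq_iff all_suc_idx B_def axis_Last)
  then show "k \<in> Kgrp"
    using k by (auto simp: Kgrp_def rotation_matrix_def block_diag_1_pseudo_orthogonal det_block_diag_1)
qed

text \<open>If \<open>g\<close> and \<open>h\<close> have the same bottom row, then \<open>h g\<^sup>-\<^sup>1\<close> fixes the last unit row vector. Hence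
  a point of the quotient is the same thing as a bottom row.\<close>

lemma orbit_eq:
  assumes g: "g \<in> pseudo_orthogonal" "det g = 1"
  shows "orbit g = {h \<in> pseudo_orthogonal. det h = 1 \<and> h $ Last = g $ Last}" (is "_ = ?R")
proof
  show "orbit g \<subseteq> ?R"
    using g by (auto simp: orbit_def Kgrp_iff pseudo_orthogonal_mult det_mul mult_row axis_vector_matrix)
  show "?R \<subseteq> orbit g"
  proof
    fix h assume h: "h \<in> ?R"
    let ?k = "h ** matrix_inv g"
    have "det (matrix_inv g) = 1"
      using pseudo_orthogonal_inverse(2)[OF g(1)] g(2) by (metis det_I det_mul mult_1)
    moreover have "?k $ Last = (g ** matrix_inv g) $ Last"
      using h by (simp add: mult_row)
    then have "?k $ Last = axis Last 1"
      unfolding pseudo_orthogonal_inverse(2)[OF g(1)] by (auto simp: mat_def vec_eq_iff axis_def)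
    ultimately have "?k \<in> Kgrp"
      using h pseudo_orthogonal_matrix_inv[OF g(1)] by (simp add: Kgrp_iff pseudo_orthogonal_mult det_mul)
    moreover have "h = ?k ** g"
      by (simp add: matrix_mul_assoc[symmetric] pseudo_orthogonal_inverse(3)[OF g(1)])
    ultimately show "h \<in> orbit g" unfolding orbit_def by blast
  qed
qed

lemma orbit_SO0:
  assumes "g \<in> SO0"
  shows "orbit g = {h \<in> pseudo_orthogonal. det h = 1 \<and> h $ Last = g $ Last}"
  using assms SO0_subset by (auto intro!: orbit_eq simp: det_SO0)

lemma orbit_eq_iff:
  assumes "g \<in> SO0" "h \<in> SO0"
  shows "orbit g = orbit h \<longleftrightarrow> g $ Last = h $ Last"
proof
  assume "orbit g = orbit h"
  moreover have "g \<in> orbit g"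
    using assms SO0_subset by (auto simp: orbit_SO0 det_SO0)
  ultimately show "g $ Last = h $ Last" using assms by (simp add: orbit_SO0)
qed (simp add: assms orbit_SO0)

section \<open>The Lie algebra and its inner product\<close>

definition lie_alg :: "'m::{finite,linorder} mat set" where
  "lie_alg = {X. X ** Jmat + Jmat ** transpose X = 0}"

lemma lie_alg_iff: "X \<in> lie_alg \<longleftrightarrow> (\<forall>i j. X $ i $ j * sig j = - (sig i * X $ j $ i))"
  proof -
  have "X \<in> lie_alg \<longleftrightarrow> (\<forall>i j. X $ i $ j * sig j + sig i * X $ j $ i = 0)"
    by (simp add: lie_alg_def vec_eq_iff transpose_def)
  then show ?thesis by (simp only: eq_neg_iff_add_eq_0)
qed

lemma lie_algD: "X \<in> lie_alg \<Longrightarrow> X $ i $ j * sig j = - (sig i * X $ j $ i)"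
  unfolding lie_alg_iff by blast

lemma lie_alg_diff:
  assumes "X \<in> lie_alg" "Y \<in> lie_alg"
  shows "X - Y \<in> lie_alg"
  unfolding lie_alg_iff
proof (intro allI)
  fix i j
  show "(X - Y) $ i $ j * sig j = - (sig i * (X - Y) $ j $ i)"
    using lie_algD[OF assms(1), of i j] lie_algD[OF assms(2), of i j]
    unfolding vector_minus_component by algebra
qed

lemma transpose_mult_Jmat: "transpose (X ** Jmat) = Jmat ** transpose X"
  by (simp add: matrix_transpose_mul transpose_Jmat)

text \<open>The Lie algebra consists of the \<open>X\<close> for which \<open>X J\<close> is skew, and conjugation by \<open>g\<close> turns
  \<open>X J\<close> into \<open>g (X J) g\<^sup>t\<close>.\<close>

lemma lie_alg_conj:
  assumes X: "X \<in> lie_alg" and g: "g \<in> pseudo_orthogonal"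
  shows "g ** X ** matrix_inv g \<in> lie_alg"
proof -
  let ?S = "X ** Jmat"
  let ?Z = "g ** X ** matrix_inv g"
  have 1: "?Z ** Jmat = g ** ?S ** transpose g"
  proof -
    have "?Z ** Jmat = g ** X ** Jmat ** transpose g ** (Jmat ** Jmat)"
      by (simp add: pseudo_orthogonal_inverse(1)[OF g] matrix_mul_assoc)
    then show ?thesis by (simp add: Jmat_Jmat matrix_mul_assoc)
  qed
  have "Jmat ** transpose ?Z = transpose (?Z ** Jmat)"
    by (simp add: transpose_mult_Jmat)
  also have "\<dots> = g ** (Jmat ** transpose X) ** transpose g"
    unfolding 1 by (simp add: matrix_transpose_mul matrix_mul_assoc transpose_Jmat)
  finally have "?Z ** Jmat + Jmat ** transpose ?Z = g ** (?S + Jmat ** transpose X) ** transpose g"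
    unfolding 1 by (simp add: matrix_add_ldistrib bounded_bilinear.add_left[OF bounded_bilinear_matrix_mult])
  then show ?thesis
    using X by (simp add: lie_alg_def bounded_bilinear.zero_left[OF bounded_bilinear_matrix_mult]
        bounded_bilinear.zero_right[OF bounded_bilinear_matrix_mult])
qed

lemma elem_mat_nth: "elem_mat i j $ a $ b = (if a = i \<and> b = j then 1 else 0)"
  by (simp add: elem_mat_def)

lemma Emat_nth:
  "Emat i j $ a $ b = (if a = i \<and> b = j then sig j else 0) + (if a = j \<and> b = i then 1 else 0)"
  by (simp add: Emat_def elem_mat_nth sig_def)

lemma elem_mat_inner: "elem_mat i j \<bullet> M = M $ i $ j"
proof -
  have "elem_mat i j = axis i (axis j 1)"
    by (simp add: vec_eq_iff elem_mat_nth axis_def)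
  then show ?thesis by (simp add: inner_axis')
qed

lemma Emat_inner: "Emat i j \<bullet> M = sig j * M $ i $ j + M $ j $ i"
  by (simp add: Emat_def inner_add_left elem_mat_inner sig_def)

lemma Emat_inner_Emat:
  assumes "i < j" "k < l"
  shows "Emat i j \<bullet> Emat k l = (if i = k \<and> j = l then 2 else 0)"
proof (cases "i = k \<and> j = l")
  case True
  then show ?thesis using less_imp_neq[OF assms(1)] by (simp add: Emat_inner Emat_nth)
next
  case False
  moreover have "\<not> (i = l \<and> j = k)"
    using assms by (metis less_asym)
  ultimately have "(i = k \<and> j = l) = False" "(i = l \<and> j = k) = False"
    "(j = k \<and> i = l) = False" "(j = l \<and> i = k) = False" by blast+
  then show ?thesis
    unfolding Emat_inner Emat_nth by (simp only: if_False mult_zero_right add_0_right)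
qed

text \<open>The frame is also orthogonal for the entrywise (Frobenius) inner product, with constant length
  \<open>sqrt 2\<close>. This gives its independence and turns \<open>ip_id\<close> into half of the Frobenius product.\<close>

lemma Eframe_inner:
  assumes "b \<in> Eframe" "b' \<in> Eframe"
  shows "b \<bullet> b' = (if b = b' then 2 else 0)"
proof -
  obtain i j k l where *: "b = Emat i j" "i < j" "b' = Emat k l" "k < l"
    using assms by (auto simp: Eframe_def)
  show ?thesis
  proof (cases "i = k \<and> j = l")
    case True
    then show ?thesis using * by (simp add: Emat_inner_Emat)
  next
    case False
    then have "b \<bullet> b' = 0" "b \<bullet> b = 2"
      unfolding *(1,3) using *(2,4) by (simp_all add: Emat_inner_Emat)
    moreover from this have "b \<noteq> b'" by (metis zero_neq_numeral)
    ultimately show ?thesis by (simp only: if_False)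
  qed
qed

lemma independent_Eframe: "independent (Eframe :: 'm::{finite,linorder} mat set)"
proof (rule pairwise_orthogonal_independent)
  show "pairwise orthogonal (Eframe :: 'm mat set)"
  proof (rule pairwiseI)
    fix b b' :: "'m mat" assume "b \<in> Eframe" "b' \<in> Eframe" "b \<noteq> b'"
    then show "orthogonal b b'"
      using Eframe_inner[of b b'] by (simp add: orthogonal_def)
  qed
  show "(0 :: 'm mat) \<notin> Eframe"
  proof
    assume "(0 :: 'm mat) \<in> Eframe"
    then show False using Eframe_inner[of "0 :: 'm mat" 0] by simp
  qed
qed

lemma finite_Eframe: "finite Eframe"
  by (rule independent_imp_finite[OF independent_Eframe])

lemma ip_id_span:
  assumes "X \<in> span Eframe" "Y \<in> span Eframe"
  shows "ip_id X Y = X \<bullet> Y / 2"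
proof -
  let ?r = "representation Eframe"
  have e: "V = (\<Sum>b\<in>Eframe. ?r V b *\<^sub>R b)" if "V \<in> span Eframe" for V :: "'a mat"
    by (rule real_vector.sum_representation_eq[OF independent_Eframe that finite_Eframe order.refl, symmetric])
  have "X \<bullet> Y = (\<Sum>b\<in>Eframe. ?r X b *\<^sub>R b) \<bullet> (\<Sum>b\<in>Eframe. ?r Y b *\<^sub>R b)"
    using e[OF assms(1)] e[OF assms(2)] by (rule arg_cong2[where f = inner])
  also have "\<dots> = (\<Sum>b'\<in>Eframe. ?r Y b' * (\<Sum>b\<in>Eframe. ?r X b * (b \<bullet> b')))"
    by (simp only: inner_sum_left inner_sum_right inner_scaleR_left inner_scaleR_right)
  also have "\<dots> = (\<Sum>b'\<in>Eframe. ?r Y b' * (\<Sum>b\<in>Eframe. if b = b' then 2 * ?r X b else 0))"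
    by (intro sum.cong refl arg_cong2[where f = "(*)"]) (simp add: Eframe_inner)
  also have "\<dots> = (\<Sum>b'\<in>Eframe. ?r Y b' * (2 * ?r X b'))"
    by (intro sum.cong refl) (simp add: finite_Eframe)
  also have "\<dots> = 2 * ip_id X Y"
    by (simp add: ip_id_def sum_distrib_left mult_ac)
  finally show ?thesis by simp
qed

lemma Emat_nth_less:
  assumes "i < j" "a < b"
  shows "Emat i j $ a $ b = (if (i, j) = (a, b) then sig b else 0)"
proof -
  have *: "(a = j \<and> b = i) = False" using assms by (metis less_asym)
  have "(a = i \<and> b = j) = ((i, j) = (a, b))" by blast
  then show ?thesis unfolding Emat_nth * if_False add_0_right by (metis prod.inject)
qed

lemma Emat_nth_greater:
  assumes "i < j" "b < a"
  shows "Emat i j $ a $ b = (if (i, j) = (b, a) then 1 else 0)"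
proof -
  have *: "(a = i \<and> b = j) = False" using assms by (metis less_asym)
  have "(a = j \<and> b = i) = ((i, j) = (b, a))" by blast
  then show ?thesis unfolding Emat_nth * if_False add_0_left by (rule arg_cong)
qed

lemma Emat_nth_diag:
  assumes "i < j"
  shows "Emat i j $ a $ a = 0"
proof -
  have "(a = i \<and> a = j) = False" "(a = j \<and> a = i) = False" using assms by (metis less_irrefl)+
  then show ?thesis unfolding Emat_nth by (simp only: if_False add_0_right)
qed

text \<open>An element of the Lie algebra is determined by its entries below the diagonal.\<close>

lemma lie_alg_expansion:
  assumes "X \<in> lie_alg"
  shows "X = (\<Sum>p | fst p < snd p. X $ snd p $ fst p *\<^sub>R Emat (fst p) (snd p))"
proof -
  let ?P = "{p :: 'a idx \<times> 'a idx. fst p < snd p}"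
  let ?t = "\<lambda>a b p. X $ snd p $ fst p * Emat (fst p) (snd p) $ a $ b"
  have fin: "finite ?P" by (rule finite_subset[OF subset_UNIV finite])
  have "X $ a $ b = (\<Sum>p\<in>?P. ?t a b p)" for a b
  proof (cases a b rule: linorder_cases)
    case less
    have "(\<Sum>p\<in>?P. ?t a b p) = (\<Sum>p\<in>?P. if p = (a, b) then X $ b $ a * sig b else 0)"
      by (intro sum.cong refl) (auto simp: Emat_nth_less[OF _ less])
    also have "\<dots> = X $ b $ a * sig b"
      using less by (simp add: sum.delta[OF fin])
    also have "\<dots> = X $ a $ b"
    proof -
      have "sig a = -1" using less by (cases a) auto
      then have "X $ a $ b * sig b = X $ b $ a" using lie_algD[OF assms, of a b] by simp
      then show ?thesis by (metis mult.assoc mult.right_neutral sig_simps(3))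
    qed
    finally show ?thesis by simp
  next
    case equal
    have "(\<Sum>p\<in>?P. ?t a b p) = 0"
      unfolding equal by (rule sum.neutral) (auto simp: Emat_nth_diag)
    moreover have "X $ a $ a = 0"
      using lie_algD[OF assms, of a a] by (cases a) auto
    ultimately show ?thesis using equal by simp
  next
    case greater
    have "(\<Sum>p\<in>?P. ?t a b p) = (\<Sum>p\<in>?P. if p = (b, a) then X $ a $ b else 0)"
      by (intro sum.cong refl) (auto simp: Emat_nth_greater[OF _ greater])
    also have "\<dots> = X $ a $ b"
      using greater by (simp add: sum.delta[OF fin])
    finally show ?thesis by simp
  qed
  then show ?thesis
    unfolding vec_eq_iff sum_component vector_scaleR_component real_scaleR_def by blast
qed

lemma lie_alg_subset_span: "lie_alg \<subseteq> span Eframe"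
proof
  fix X :: "'a mat" assume "X \<in> lie_alg"
  then have "X = (\<Sum>p | fst p < snd p. X $ snd p $ fst p *\<^sub>R Emat (fst p) (snd p))"
    by (rule lie_alg_expansion)
  also have "\<dots> \<in> span Eframe"
    by (intro span_sum span_scale span_base) (auto simp: Eframe_def)
  finally show "X \<in> span Eframe" .
qed

lemma ip_id_lie_alg: "X \<in> lie_alg \<Longrightarrow> Y \<in> lie_alg \<Longrightarrow> ip_id X Y = X \<bullet> Y / 2"
  using ip_id_span lie_alg_subset_span by blast

section \<open>One-parameter subgroups and tangent spaces\<close>

text \<open>For \<open>(c, s) = (cos t, sin t)\<close>, or \<open>(cosh t, sinh t)\<close> if \<open>j\<close> is the time index, this is the
  exponential of \<open>t Emat i j\<close>: a rotation or a boost in the plane of \<open>i\<close> and \<open>j\<close>.\<close>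

definition plane_mat :: "'m::{finite,linorder} idx \<Rightarrow> 'm idx \<Rightarrow> real \<Rightarrow> real \<Rightarrow> 'm mat" where
  "plane_mat i j c s = mat 1 + (c - 1) *\<^sub>R (elem_mat i i + elem_mat j j) + s *\<^sub>R Emat i j"

lemma plane_mat_row:
  assumes "i \<noteq> j"
  shows "plane_mat i j c s $ a =
    (if a = i then c *\<^sub>R axis i 1 + (s * sig j) *\<^sub>R axis j 1
     else if a = j then s *\<^sub>R axis i 1 + c *\<^sub>R axis j 1 else axis a 1)"
  using assms by (auto simp: vec_eq_iff plane_mat_def mat_def axis_def elem_mat_nth Emat_nth)

lemma lor_axis: "lor (axis a 1) (axis b 1) = (if a = b then sig a else 0)"
proof -
  have "lor (axis a 1) (axis b 1) = (\<Sum>i\<in>UNIV. if i = a then sig a * axis b 1 $ a else 0)"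
    unfolding lor_sum by (rule sum.cong) (auto simp: axis_def)
  then show ?thesis by (simp add: axis_def)
qed

lemmas lor_bilinear_simps =
  bounded_bilinear.add_left[OF bounded_bilinear_lor] bounded_bilinear.add_right[OF bounded_bilinear_lor]
  bounded_bilinear.scaleR_left[OF bounded_bilinear_lor] bounded_bilinear.scaleR_right[OF bounded_bilinear_lor]

lemma plane_mat_pseudo_orthogonal:
  assumes "i < j" and cs: "c\<^sup>2 - sig j * s\<^sup>2 = 1"
  shows "plane_mat i j c s \<in> pseudo_orthogonal"
proof -
  have i: "sig i = -1" using \<open>i < j\<close> by (metis less_suc_idx_simps(3) sig_def)
  have ne: "i \<noteq> j" using \<open>i < j\<close> by (rule less_imp_neq)
  have j: "sig j * sig j = 1" by simp
  let ?M = "plane_mat i j c s"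
  have rows: "?M $ i = c *\<^sub>R axis i 1 + (s * sig j) *\<^sub>R axis j 1"
    "?M $ j = s *\<^sub>R axis i 1 + c *\<^sub>R axis j 1"
    "a \<noteq> i \<Longrightarrow> a \<noteq> j \<Longrightarrow> ?M $ a = axis a 1" for a
    using ne ne[symmetric] by (simp_all add: plane_mat_row[OF ne])
  have lor2: "lor (x *\<^sub>R axis i 1 + y *\<^sub>R axis j 1) (z *\<^sub>R axis i 1 + w *\<^sub>R axis j 1)
      = sig j * y * w - x * z" for x y z w
    using ne ne[symmetric] by (simp add: lor_bilinear_simps lor_axis i)
  have lor1: "lor (x *\<^sub>R axis i 1 + y *\<^sub>R axis j 1) (axis a 1) = 0"
    if "a \<noteq> i" "a \<noteq> j" for x y a
    using that that[symmetric] by (simp add: lor_bilinear_simps lor_axis)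
  have ii: "lor (?M $ i) (?M $ i) = sig i"
    unfolding rows lor2 i using cs j by algebra
  have jj: "lor (?M $ j) (?M $ j) = sig j"
    unfolding rows lor2 using cs j by algebra
  have ij: "lor (?M $ i) (?M $ j) = 0"
    unfolding rows lor2 using j by algebra
  have o: "lor (?M $ i) (?M $ a) = 0" "lor (?M $ j) (?M $ a) = 0" if "a \<noteq> i" "a \<noteq> j" for a
    unfolding rows(3)[OF that] unfolding rows(1,2) by (rule lor1[OF that])+
  have oo: "lor (?M $ a) (?M $ b) = (if a = b then sig a else 0)"
    if "a \<noteq> i" "a \<noteq> j" "b \<noteq> i" "b \<noteq> j" for a b
    unfolding rows(3)[OF that(1,2)] rows(3)[OF that(3,4)] by (rule lor_axis)
  show ?thesis
    unfolding pseudo_orthogonal_iff_lor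
  proof (intro allI)
    fix a b
    show "lor (?M $ a) (?M $ b) = (if a = b then sig a else 0)"
      using ii jj ij o[of a] o[of b] oo[of a b] lor_commute[of "?M $ a" "?M $ b"] ne
      by (cases "a = i"; cases "a = j"; cases "b = i"; cases "b = j") auto
  qed
qed

lemma smooth_curve_in_mem:
  assumes "smooth_curve_in S c"
  obtains e where "e > 0" "\<And>t. t \<in> {-e<..<e} \<Longrightarrow> c t \<in> S"
  using assms unfolding smooth_curve_in_def by blast

lemma Ck_on_subset: "Ck_on k S f \<Longrightarrow> T \<subseteq> S \<Longrightarrow> Ck_on k T f"
  by (induction k arbitrary: f) (auto intro: continuous_on_subset)

text \<open>The curve of rotations or boosts is connected and starts at the identity, hence stays in the
  identity component; if the time index is not involved, then it also fixes the last unit row vector.\<close>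

lemma plane_curve_tangent:
  fixes c s :: "real \<Rightarrow> real"
  assumes ij: "i < j"
    and smooth: "\<And>k. Ck_on k UNIV c" "\<And>k. Ck_on k UNIV s"
    and hyp: "\<And>t. (c t)\<^sup>2 - sig j * (s t)\<^sup>2 = 1" and init: "c 0 = 1" "s 0 = 0"
    and deriv: "(c has_real_derivative 0) (at 0)" "(s has_real_derivative a) (at 0)"
  shows "a *\<^sub>R Emat i j \<in> tangent_space SO0 (mat 1)"
    and "j \<noteq> Last \<Longrightarrow> a *\<^sub>R Emat i j \<in> tangent_space Kgrp (mat 1)"
proof -
  let ?g = "\<lambda>t. plane_mat i j (c t) (s t)"
  have smooth_g: "Ck_on k UNIV ?g" for k
  proof -
    have "Ck_on k UNIV (\<lambda>t. mat 1 + ((c t + - 1) *\<^sub>R (elem_mat i i + elem_mat j j) + s t *\<^sub>R Emat i j))"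
      by (intro Ck_on_add Ck_on_scaleR Ck_on_const smooth open_UNIV)
    then show ?thesis by (simp add: plane_mat_def add.assoc)
  qed
  have g0: "?g 0 = mat 1" by (simp add: plane_mat_def init)
  have dg: "(?g has_vector_derivative a *\<^sub>R Emat i j) (at 0)"
  proof -
    have "((\<lambda>t. c t - 1) has_vector_derivative 0) (at 0)" "(s has_vector_derivative a) (at 0)"
      unfolding has_real_derivative_iff_has_vector_derivative[symmetric]
      using deriv by (auto intro!: derivative_eq_intros)
    then have "(?g has_vector_derivative
        0 + (0 *\<^sub>R (elem_mat i i + elem_mat j j)) + a *\<^sub>R Emat i j) (at 0)"
      unfolding plane_mat_def
      by (intro has_vector_derivative_add has_vector_derivative_const
          bounded_linear.has_vector_derivative[OF bounded_linear_scaleR_left])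
    then show ?thesis by simp
  qed
  have SO0: "?g t \<in> SO0" for t
  proof -
    have "range ?g \<subseteq> SO0"
    proof (rule SO0_connected_subset[where a = "?g 0"])
      show "connected (range ?g)"
        using smooth_g[of 0] by (intro connected_continuous_image) auto
      show "range ?g \<subseteq> pseudo_orthogonal"
        using plane_mat_pseudo_orthogonal[OF ij hyp] by blast
      show "?g 0 \<in> range ?g" by (rule rangeI)
      show "?g 0 \<in> SO0" unfolding g0 by (rule mat_1_SO0)
    qed
    then show ?thesis by blast
  qed
  have tangentI: "a *\<^sub>R Emat i j \<in> tangent_space H (mat 1)" if "\<And>t. ?g t \<in> H" for H
    unfolding tangent_space_def smooth_curve_in_def smooth_on_open_def
    using that g0 dg Ck_on_subset[OF smooth_g]
    by (auto intro!: exI[of _ ?g] exI[of _ 1])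
  show "a *\<^sub>R Emat i j \<in> tangent_space SO0 (mat 1)"
    using SO0 by (rule tangentI)
  assume "j \<noteq> Last"
  then have "?g t $ Last = axis Last 1" for t
    using ij plane_mat_row[of i j "c t" "s t" Last] by (cases "i = Last") auto
  then have "?g t \<in> Kgrp" for t
    using SO0[of t] SO0_subset det_SO0 by (auto simp: Kgrp_iff)
  then show "a *\<^sub>R Emat i j \<in> tangent_space Kgrp (mat 1)"
    by (rule tangentI)
qed

lemma Emat_tangent:
  assumes ij: "i < j"
  shows "a *\<^sub>R Emat i j \<in> tangent_space SO0 (mat 1)"
    and "j \<noteq> Last \<Longrightarrow> a *\<^sub>R Emat i j \<in> tangent_space Kgrp (mat 1)"
proof -
  have hyp: "a *\<^sub>R Emat i j \<in> tangent_space SO0 (mat 1)" if "j = Last"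
    using ij
    by (rule plane_curve_tangent(1)[where c = "\<lambda>t. cosh (a * t)" and s = "\<lambda>t. sinh (a * t)"])
      (auto simp: that Ck_on_hyperbolic cosh_square_eq intro!: derivative_eq_intros)
  have rot: "a *\<^sub>R Emat i j \<in> tangent_space SO0 (mat 1)"
    "a *\<^sub>R Emat i j \<in> tangent_space Kgrp (mat 1)" if "j \<noteq> Last"
  proof -
    have d: "((\<lambda>t. cos (a * t)) has_real_derivative 0) (at 0)"
      "((\<lambda>t. sin (a * t)) has_real_derivative a) (at 0)"
      by (auto intro!: derivative_eq_intros)
    have id: "(cos (a * t))\<^sup>2 - sig j * (sin (a * t))\<^sup>2 = 1" for t
      using that by (simp add: sig_def)
    note curve = plane_curve_tangent[OF ij Ck_on_trig[OF open_UNIV] id _ _ d]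
    show "a *\<^sub>R Emat i j \<in> tangent_space SO0 (mat 1)"
      by (rule curve(1)) simp_all
    show "a *\<^sub>R Emat i j \<in> tangent_space Kgrp (mat 1)"
      by (rule curve(2)) (simp_all add: that)
  qed
  then show "a *\<^sub>R Emat i j \<in> tangent_space SO0 (mat 1)"
    and "j \<noteq> Last \<Longrightarrow> a *\<^sub>R Emat i j \<in> tangent_space Kgrp (mat 1)"
    using hyp rot by blast+
qed

lemma tangent_space_mono: "S \<subseteq> T \<Longrightarrow> tangent_space S p \<subseteq> tangent_space T p"
  unfolding tangent_space_def smooth_curve_in_def by blast

lemma smooth_curve_in_linear_image:
  assumes L: "bounded_linear L" and "L ` S \<subseteq> T" "smooth_curve_in S c"
  shows "smooth_curve_in T (\<lambda>t. L (c t))"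
  using assms(2,3) Ck_on_linear_comp[OF L]
  unfolding smooth_curve_in_def smooth_on_open_def by blast

lemma tangent_space_linear_image:
  assumes L: "bounded_linear L" and LS: "L ` S \<subseteq> T" and X: "X \<in> tangent_space S p"
  shows "L X \<in> tangent_space T (L p)"
proof -
  obtain c where "smooth_curve_in S c" "c 0 = p" "(c has_vector_derivative X) (at 0)"
    using X unfolding tangent_space_def by blast
  then show ?thesis
    using smooth_curve_in_linear_image[OF L LS] bounded_linear.has_vector_derivative[OF L]
    unfolding tangent_space_def by blast
qed

lemma tangent_space_zero: "p \<in> S \<Longrightarrow> 0 \<in> tangent_space S p"
  unfolding tangent_space_def smooth_curve_in_def smooth_on_open_def
  by (auto intro!: exI[of _ "\<lambda>_. p"] exI[of _ 1] Ck_on_const)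

text \<open>The velocity at the identity of a product of two curves is the sum of their velocities.\<close>

lemma tangent_space_add:
  fixes H :: "(real^'n^'n) set"
  assumes H: "\<And>A B. A \<in> H \<Longrightarrow> B \<in> H \<Longrightarrow> A ** B \<in> H"
    and X: "X \<in> tangent_space H (mat 1)" and Y: "Y \<in> tangent_space H (mat 1)"
  shows "X + Y \<in> tangent_space H (mat 1)"
proof -
  obtain c where c: "smooth_curve_in H c" "c 0 = mat 1" "(c has_vector_derivative X) (at 0)"
    using X unfolding tangent_space_def by blast
  obtain d where d: "smooth_curve_in H d" "d 0 = mat 1" "(d has_vector_derivative Y) (at 0)"
    using Y unfolding tangent_space_def by blast
  obtain e1 where e1: "e1 > 0" "\<And>k. Ck_on k {-e1<..<e1} c" "\<And>t. t \<in> {-e1<..<e1} \<Longrightarrow> c t \<in> H"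
    using smooth_curve_inE[OF c(1)] by blast
  obtain e2 where e2: "e2 > 0" "\<And>k. Ck_on k {-e2<..<e2} d" "\<And>t. t \<in> {-e2<..<e2} \<Longrightarrow> d t \<in> H"
    using smooth_curve_inE[OF d(1)] by blast
  let ?e = "min e1 e2"
  have "Ck_on k {-?e<..<?e} (\<lambda>t. c t ** d t)" for k
    by (intro Ck_on_bilinear[OF bounded_bilinear_matrix_mult] Ck_on_subset[OF e1(2)]
        Ck_on_subset[OF e2(2)]) auto
  then have "smooth_curve_in H (\<lambda>t. c t ** d t)"
    unfolding smooth_curve_in_def smooth_on_open_def using e1 e2 H
    by (intro exI[of _ ?e]) auto
  moreover have "((\<lambda>t. c t ** d t) has_vector_derivative c 0 ** Y + X ** d 0) (at 0)"
    by (rule bounded_bilinear.has_vector_derivative[OF bounded_bilinear_matrix_mult c(3) d(3)])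
  ultimately show ?thesis
    unfolding tangent_space_def using c(2) d(2) by (auto intro!: exI[of _ "\<lambda>t. c t ** d t"] simp: add.commute)
qed

lemma tangent_space_sum:
  fixes H :: "(real^'n^'n) set"
  assumes H: "\<And>A B. A \<in> H \<Longrightarrow> B \<in> H \<Longrightarrow> A ** B \<in> H" "mat 1 \<in> H"
    and "\<And>i. i \<in> I \<Longrightarrow> X i \<in> tangent_space H (mat 1)"
  shows "sum X I \<in> tangent_space H (mat 1)"
  using assms(3)
  by (induction I rule: infinite_finite_induct) (auto intro: tangent_space_zero tangent_space_add H)

text \<open>Multiplying the one-parameter subgroups of the frame vectors realizes any combination of them
  as a velocity; the exponential of a general matrix is thereby avoided.\<close>

lemma lie_alg_subset_tangent_SO0: "lie_alg \<subseteq> tangent_space SO0 (mat 1)"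
proof
  fix X :: "'a mat" assume "X \<in> lie_alg"
  then have "X = (\<Sum>p | fst p < snd p. X $ snd p $ fst p *\<^sub>R Emat (fst p) (snd p))"
    by (rule lie_alg_expansion)
  also have "\<dots> \<in> tangent_space SO0 (mat 1)"
    by (rule tangent_space_sum) (auto intro: SO0_mult mat_1_SO0 Emat_tangent)
  finally show "X \<in> tangent_space SO0 (mat 1)" .
qed

lemma Kgrp_mult: "A \<in> Kgrp \<Longrightarrow> B \<in> Kgrp \<Longrightarrow> A ** B \<in> Kgrp"
  by (simp add: Kgrp_iff pseudo_orthogonal_mult det_mul mult_row axis_vector_matrix)

lemma mat_1_Kgrp: "(mat 1 :: 'm::{finite,linorder} mat) \<in> Kgrp"
proof -
  have "(mat 1 :: 'm mat) $ Last = axis Last 1"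
    by (auto simp: vec_eq_iff mat_def axis_def)
  then show ?thesis by (simp add: Kgrp_iff mat_1_pseudo_orthogonal)
qed

text \<open>If the bottom row vanishes, then only frame vectors of the rotation subgroup occur in the
  expansion.\<close>

lemma lie_alg_tangent_Kgrp:
  assumes "X \<in> lie_alg" "X $ Last = 0"
  shows "X \<in> tangent_space Kgrp (mat 1)"
proof -
  have "X = (\<Sum>p | fst p < snd p. X $ snd p $ fst p *\<^sub>R Emat (fst p) (snd p))"
    by (rule lie_alg_expansion[OF assms(1)])
  also have "\<dots> \<in> tangent_space Kgrp (mat 1)"
  proof (rule tangent_space_sum)
    fix p :: "'a idx \<times> 'a idx" assume p: "p \<in> {p. fst p < snd p}"
    show "X $ snd p $ fst p *\<^sub>R Emat (fst p) (snd p) \<in> tangent_space Kgrp (mat 1)"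
      using p assms(2) Emat_tangent(2)[of "fst p" "snd p"]
      by (cases "snd p = Last") (auto intro: tangent_space_zero mat_1_Kgrp)
  qed (auto intro: Kgrp_mult mat_1_Kgrp)
  finally show ?thesis .
qed

lemma bounded_linear_matrix_mult_left: "bounded_linear (\<lambda>X. A ** X)" for A :: "real^'n^'m"
  by (rule bounded_bilinear.bounded_linear_right[OF bounded_bilinear_matrix_mult])

lemma bounded_linear_matrix_mult_right: "bounded_linear (\<lambda>X. X ** A)" for A :: "real^'n^'m"
  by (rule bounded_bilinear.bounded_linear_left[OF bounded_bilinear_matrix_mult])

lemma tangent_SO0I:
  assumes "g \<in> SO0" "X \<in> lie_alg"
  shows "g ** X \<in> tangent_space SO0 g"
  using tangent_space_linear_image[OF bounded_linear_matrix_mult_left[of g], of SO0 SO0 X "mat 1"]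
    assms lie_alg_subset_tangent_SO0 SO0_mult by auto

text \<open>In the left trivialization \<open>Y\<close> of a tangent vector at \<open>g\<close>, the vertical space is the kernel of
  \<open>Y \<mapsto> r Y\<close> with \<open>r\<close> the bottom row of \<open>g\<close>: for such \<open>Y\<close> the conjugate \<open>g Y g\<^sup>-\<^sup>1\<close> has
  vanishing bottom row, so it is the velocity of a curve in \<open>Kgrp\<close>, which acts on \<open>g\<close> from the left.\<close>

lemma tangent_orbitI:
  assumes g: "g \<in> SO0" and Y: "Y \<in> lie_alg" and r: "g $ Last v* Y = 0"
  shows "g ** Y \<in> tangent_space (orbit g) g"
proof -
  have gP: "g \<in> pseudo_orthogonal" using g SO0_subset by blast
  let ?Z = "g ** Y ** matrix_inv g"
  have "?Z $ Last = 0" by (simp add: mult_row r)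
  then have "?Z \<in> tangent_space Kgrp (mat 1)"
    by (intro lie_alg_tangent_Kgrp lie_alg_conj Y gP)
  then have "?Z ** g \<in> tangent_space (orbit g) (mat 1 ** g)"
    by (rule tangent_space_linear_image[OF bounded_linear_matrix_mult_right, rotated])
      (auto simp: orbit_def)
  moreover have "?Z ** g = g ** Y"
    by (simp add: matrix_mul_assoc[symmetric] pseudo_orthogonal_inverse(3)[OF gP])
  ultimately show ?thesis by simp
qed

text \<open>Differentiate \<open>c J c\<^sup>t = J\<close> along a curve and multiply by \<open>g\<^sup>-\<^sup>1\<close> from the left and its
  transpose from the right.\<close>

lemma tangent_pseudo_orthogonal:
  assumes g: "g \<in> pseudo_orthogonal" and u: "u \<in> tangent_space pseudo_orthogonal g"
  shows "matrix_inv g ** u \<in> lie_alg"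
proof -
  obtain c where c: "smooth_curve_in pseudo_orthogonal c" "c 0 = g" "(c has_vector_derivative u) (at 0)"
    using u unfolding tangent_space_def by blast
  obtain e where e: "e > 0" "\<And>t. t \<in> {-e<..<e} \<Longrightarrow> c t \<in> pseudo_orthogonal"
    using smooth_curve_inE[OF c(1)] by blast
  have nth: "((\<lambda>t. c t $ i) has_vector_derivative u $ i) (at 0)" for i
    by (rule bounded_linear.has_vector_derivative[OF bounded_linear_vec_nth c(3)])
  have l: "lor (g $ i) (u $ j) + lor (u $ i) (g $ j) = 0" for i j
  proof -
    have "((\<lambda>t. lor (c t $ i) (c t $ j)) has_vector_derivative
        lor (c 0 $ i) (u $ j) + lor (u $ i) (c 0 $ j)) (at 0)"
      by (rule bounded_bilinear.has_vector_derivative[OF bounded_bilinear_lor nth nth])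
    moreover have "((\<lambda>t. lor (c t $ i) (c t $ j)) has_vector_derivative 0) (at 0)"
    proof (rule has_vector_derivative_transform_within_open[where S = "{-e<..<e}"])
      show "((\<lambda>t. if i = j then sig i else 0) has_vector_derivative 0) (at 0)" by simp
      show "(if i = j then sig i else 0) = lor (c t $ i) (c t $ j)" if "t \<in> {-e<..<e}" for t
        using e(2)[OF that] by (simp add: pseudo_orthogonal_iff_lor)
    qed (use e(1) in auto)
    ultimately show ?thesis
      using c(2) vector_derivative_unique_at by blast
  qed
  have M: "u ** Jmat ** transpose g + g ** Jmat ** transpose u = 0"
    unfolding vec_eq_iff
  proof (intro allI)
    fix i j
    have *: "(A ** Jmat ** transpose B) $ i $ j = lor (A $ i) (B $ j)" for A B :: "'a mat"
      by (simp add: matrix_matrix_mult_def[of "A ** Jmat"] transpose_def lor_sum)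
    show "(u ** Jmat ** transpose g + g ** Jmat ** transpose u) $ i $ j = 0 $ i $ j"
      using l[of i j] by (simp add: *)
  qed
  let ?B = "matrix_inv g"
  have Bg: "?B ** g = mat 1" by (rule pseudo_orthogonal_inverse(3)[OF g])
  have gB: "transpose g ** transpose ?B = mat 1"
    by (simp add: Bg flip: matrix_transpose_mul)
  have "?B ** (u ** Jmat ** transpose g + g ** Jmat ** transpose u) ** transpose ?B
      = ?B ** u ** Jmat ** (transpose g ** transpose ?B) + (?B ** g) ** Jmat ** (transpose u ** transpose ?B)"
    by (simp add: matrix_add_ldistrib bounded_bilinear.add_left[OF bounded_bilinear_matrix_mult]
        matrix_mul_assoc)
  also have "\<dots> = ?B ** u ** Jmat + Jmat ** transpose (?B ** u)"
    by (simp add: gB Bg matrix_transpose_mul)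
  finally show ?thesis
    unfolding lie_alg_def M
    by (simp add: bounded_bilinear.zero_left[OF bounded_bilinear_matrix_mult]
        bounded_bilinear.zero_right[OF bounded_bilinear_matrix_mult])
qed

lemma tangent_SO0:
  assumes "g \<in> SO0" "u \<in> tangent_space SO0 g"
  obtains X where "X \<in> lie_alg" "u = g ** X" "matrix_inv g ** u = X"
proof
  have gP: "g \<in> pseudo_orthogonal" using assms SO0_subset by blast
  show "matrix_inv g ** u \<in> lie_alg"
    using assms tangent_space_mono[OF SO0_subset] by (intro tangent_pseudo_orthogonal gP) blast
  show "u = g ** (matrix_inv g ** u)"
    by (simp add: matrix_mul_assoc pseudo_orthogonal_inverse(2)[OF gP])
qed simp

lemma tangent_orbit:
  assumes g: "g \<in> SO0" and w: "w \<in> tangent_space (orbit g) g"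
  obtains Y where "Y \<in> lie_alg" "w = g ** Y" "matrix_inv g ** w = Y" "g $ Last v* Y = 0"
proof
  have gP: "g \<in> pseudo_orthogonal" using g SO0_subset by blast
  show "matrix_inv g ** w \<in> lie_alg"
    using w tangent_space_mono[of "orbit g" pseudo_orthogonal]
    by (intro tangent_pseudo_orthogonal gP) (auto simp: orbit_SO0[OF g])
  show eq: "w = g ** (matrix_inv g ** w)"
    by (simp add: matrix_mul_assoc pseudo_orthogonal_inverse(2)[OF gP])
  \<comment> \<open>the bottom row is constant along a curve in the orbit\<close>
  obtain c where c: "smooth_curve_in (orbit g) c" "c 0 = g" "(c has_vector_derivative w) (at 0)"
    using w unfolding tangent_space_def by blast
  obtain e where e: "e > 0" "\<And>t. t \<in> {-e<..<e} \<Longrightarrow> c t \<in> orbit g"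
    by (rule smooth_curve_in_mem[OF c(1)]) (rule that)
  have "((\<lambda>t. c t $ Last) has_vector_derivative w $ Last) (at 0)"
    by (rule bounded_linear.has_vector_derivative[OF bounded_linear_vec_nth c(3)])
  moreover have "((\<lambda>t. c t $ Last) has_vector_derivative 0) (at 0)"
  proof (rule has_vector_derivative_transform_within_open[where S = "{-e<..<e}"])
    show "((\<lambda>t. g $ Last) has_vector_derivative 0) (at 0)" by simp
    show "g $ Last = c t $ Last" if "t \<in> {-e<..<e}" for t
      using e(2)[OF that] by (simp add: orbit_SO0[OF g])
  qed (use e(1) in auto)
  ultimately have "w $ Last = 0" using vector_derivative_unique_at by blast
  then show "g $ Last v* (matrix_inv g ** w) = 0"
    using eq by (metis mult_row)
qed simp

section \<open>Horizontal lifts\<close>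

text \<open>The matrix \<open>(r\<^sup>t \<rho> - J \<rho>\<^sup>t r J) / \<bar>r\<bar>\<^sup>2\<close>. The horizontal space is the orthogonal complement of
  the kernel of \<open>X \<mapsto> r X\<close> on the Lie algebra, that is, the range of the adjoint map, which is
  \<open>q \<mapsto> r\<^sup>t q - J q\<^sup>t r J\<close>. Tangency of \<open>\<rho>\<close> to the hyperboloid at \<open>r\<close> makes \<open>q = \<rho> / \<bar>r\<bar>\<^sup>2\<close> the
  right argument for a lift of \<open>\<rho>\<close>.\<close>

definition hor_lift :: "(real, 'm::{finite,linorder} idx) vec \<Rightarrow> (real, 'm idx) vec \<Rightarrow> 'm mat" where
  "hor_lift r \<rho> = (\<chi> i j. (r $ i * \<rho> $ j - sig i * \<rho> $ i * (r $ j * sig j)) / (r \<bullet> r))"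

lemma hor_lift_lie_alg: "hor_lift r \<rho> \<in> lie_alg"
proof -
  have "(x * y - s * z * (w * t)) / d * t = - (s * ((w * z - t * y * (x * s)) / d))"
    if "s * s = 1" "t * t = 1" for x y s z w t d :: real
  proof -
    have "(x * y - s * z * (w * t)) * t = - (s * (w * z - t * y * (x * s)))"
      using that by algebra
    then show ?thesis
      unfolding times_divide_eq_left times_divide_eq_right minus_divide_left by (rule arg_cong)
  qed
  then show ?thesis by (simp add: lie_alg_iff hor_lift_def)
qed

lemma row_hor_lift:
  assumes "lor r r = 1" "lor r \<rho> = 0"
  shows "r v* hor_lift r \<rho> = \<rho>"
proof -
  have "r \<noteq> 0" using assms(1) by (auto simp: lor_sum)
  then have nz: "r \<bullet> r \<noteq> 0" by simp
  have "(r v* hor_lift r \<rho>) $ j = \<rho> $ j" for j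
  proof -
    have "(r v* hor_lift r \<rho>) $ j
        = (\<Sum>i\<in>UNIV. (r $ i * r $ i) * (\<rho> $ j / (r \<bullet> r)) - (r $ i * sig i * \<rho> $ i) * (r $ j * sig j / (r \<bullet> r)))"
      unfolding vector_matrix_mult_def hor_lift_def
      by (simp add: diff_divide_distrib algebra_simps)
    also have "\<dots> = (r \<bullet> r) * (\<rho> $ j / (r \<bullet> r)) - lor r \<rho> * (r $ j * sig j / (r \<bullet> r))"
      by (simp only: sum_subtractf inner_vec_def lor_sum sum_distrib_right inner_real_def)
    finally show ?thesis using nz by (simp add: assms)
  qed
  then show ?thesis by (simp add: vec_eq_iff)
qed

text \<open>The adjointness that makes \<open>hor_lift\<close> horizontal and at the same time computes the metric on it.\<close>

lemma hor_lift_inner: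
  assumes "Y \<in> lie_alg"
  shows "hor_lift r \<rho> \<bullet> Y = 2 * ((r v* Y) \<bullet> \<rho>) / (r \<bullet> r)"
proof -
  let ?q = "\<lambda>i j. r $ i * Y $ i $ j * \<rho> $ j / (r \<bullet> r)"
  have s: "sig i * (sig j * Y $ i $ j) = - Y $ j $ i" for i j
  proof -
    have "Y $ i $ j * sig j = - (sig i * Y $ j $ i)" by (rule lie_algD[OF assms])
    then have "sig i * (sig j * Y $ i $ j) = - ((sig i * sig i) * Y $ j $ i)" by algebra
    then show ?thesis by simp
  qed
  have "hor_lift r \<rho> \<bullet> Y = (\<Sum>i\<in>UNIV. \<Sum>j\<in>UNIV. ?q i j + ?q j i)"
    unfolding inner_vec_def[of "hor_lift r \<rho>"] inner_vec_def[of "hor_lift r \<rho> $ _"]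
  proof (intro sum.cong refl)
    fix i j
    have "hor_lift r \<rho> $ i $ j \<bullet> Y $ i $ j
        = (r $ i * \<rho> $ j * Y $ i $ j - \<rho> $ i * r $ j * (sig i * (sig j * Y $ i $ j))) / (r \<bullet> r)"
      by (simp add: hor_lift_def algebra_simps)
    also have "\<dots> = ?q i j + ?q j i"
      unfolding s by (simp add: add_divide_distrib algebra_simps)
    finally show "hor_lift r \<rho> $ i $ j \<bullet> Y $ i $ j = ?q i j + ?q j i" .
  qed
  also have "\<dots> = (\<Sum>i\<in>UNIV. \<Sum>j\<in>UNIV. ?q i j) + (\<Sum>i\<in>UNIV. \<Sum>j\<in>UNIV. ?q j i)"
    by (simp only: sum.distrib)
  also have "(\<Sum>i\<in>UNIV. \<Sum>j\<in>UNIV. ?q j i) = (\<Sum>i\<in>UNIV. \<Sum>j\<in>UNIV. ?q i j)"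
    by (rule sum.swap)
  also have "(\<Sum>i\<in>UNIV. \<Sum>j\<in>UNIV. ?q i j) = (\<Sum>j\<in>UNIV. \<Sum>i\<in>UNIV. ?q i j)"
    by (rule sum.swap)
  also have "\<dots> = (r v* Y) \<bullet> \<rho> / (r \<bullet> r)"
    unfolding inner_vec_def[of "r v* Y"]
    by (simp add: vector_matrix_mult_def sum_distrib_left sum_distrib_right sum_divide_distrib mult_ac)
  finally show ?thesis by simp
qed

lemma lor_lie_alg:
  assumes "X \<in> lie_alg"
  shows "lor r (r v* X) = 0"
proof -
  let ?q = "\<lambda>i j. r $ j * (X $ i $ j * sig j) * r $ i"
  have "lor r (r v* X) = (\<Sum>j\<in>UNIV. \<Sum>i\<in>UNIV. ?q i j)"
    by (simp add: lor_sum vector_matrix_mult_def sum_distrib_left mult_ac)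
  moreover have "?q i j = - ?q j i" for i j
    using lie_algD[OF assms, of i j] by algebra
  then have "(\<Sum>j\<in>UNIV. \<Sum>i\<in>UNIV. ?q i j) = (\<Sum>j\<in>UNIV. \<Sum>i\<in>UNIV. - ?q j i)"
    by (intro sum.cong refl)
  moreover have "\<dots> = - (\<Sum>j\<in>UNIV. \<Sum>i\<in>UNIV. ?q i j)"
    using sum.swap[of ?q UNIV UNIV] by (simp add: sum_negf)
  ultimately show ?thesis by linarith
qed

lemma horizontal_lift_exists:
  assumes g: "g \<in> SO0" and "lor (g $ Last) \<rho> = 0"
  obtains u where "u \<in> horizontal_space g" "u $ Last = \<rho>"
proof
  let ?X = "hor_lift (g $ Last) \<rho>"
  have gP: "g \<in> pseudo_orthogonal" using g SO0_subset by blast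
  have inv: "matrix_inv g ** (g ** ?X) = ?X"
    by (simp add: matrix_mul_assoc pseudo_orthogonal_inverse(3)[OF gP])
  show "(g ** ?X) $ Last = \<rho>"
    by (simp add: mult_row row_hor_lift assms lor_self_row_Last gP)
  have "metric_G g (g ** ?X) w = 0" if w: "w \<in> tangent_space (orbit g) g" for w
  proof -
    obtain Y where Y: "Y \<in> lie_alg" "matrix_inv g ** w = Y" "g $ Last v* Y = 0"
      using tangent_orbit[OF g w] by blast
    show ?thesis
      by (simp add: metric_G_def inv Y ip_id_lie_alg[OF hor_lift_lie_alg Y(1)] hor_lift_inner)
  qed
  then show "g ** ?X \<in> horizontal_space g"
    unfolding horizontal_space_def using tangent_SO0I[OF g hor_lift_lie_alg] by blast
qed

text \<open>A horizontal vector differs from the explicit lift of its bottom row by a vertical vector, which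
  is orthogonal to the other horizontal vector. The lengths of horizontal vectors are therefore
  Euclidean lengths of bottom rows, rescaled by the length of the base point.\<close>

lemma metric_horizontal:
  assumes g: "g \<in> SO0" and u: "u \<in> horizontal_space g" and w: "w \<in> horizontal_space g"
  shows "metric_G g u w = (u $ Last \<bullet> w $ Last) / (g $ Last \<bullet> g $ Last)"
proof -
  have gP: "g \<in> pseudo_orthogonal" using g SO0_subset by blast
  obtain X where X: "X \<in> lie_alg" "u = g ** X" "matrix_inv g ** u = X"
    using u tangent_SO0[OF g, of u] unfolding horizontal_space_def by blast
  obtain W where W: "W \<in> lie_alg" "w = g ** W" "matrix_inv g ** w = W"
    using w tangent_SO0[OF g, of w] unfolding horizontal_space_def by blast
  let ?r = "g $ Last"
  let ?L = "hor_lift ?r (u $ Last)"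
  have uL: "u $ Last = ?r v* X" "w $ Last = ?r v* W" by (simp_all add: X W mult_row)
  let ?Y = "X - ?L"
  have Y: "?Y \<in> lie_alg" by (intro lie_alg_diff X hor_lift_lie_alg)
  have "?r v* ?L = u $ Last"
    unfolding uL by (intro row_hor_lift lor_lie_alg X lor_self_row_Last gP)
  then have "?r v* ?Y = 0"
    by (simp add: vector_matrix_mult_diff_rdistrib uL)
  then have "g ** ?Y \<in> tangent_space (orbit g) g"
    by (intro tangent_orbitI g Y)
  then have "metric_G g w (g ** ?Y) = 0"
    using w unfolding horizontal_space_def by blast
  then have "W \<bullet> ?Y = 0"
    by (simp add: metric_G_def W(3) matrix_mul_assoc pseudo_orthogonal_inverse(3)[OF gP]
        ip_id_lie_alg[OF W(1) Y])
  then have "X \<bullet> W = ?L \<bullet> W"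
    by (simp add: inner_diff_right inner_commute)
  also have "\<dots> = 2 * (w $ Last \<bullet> u $ Last) / (?r \<bullet> ?r)"
    unfolding uL(2) by (rule hor_lift_inner[OF W(1)])
  finally have "X \<bullet> W = 2 * (u $ Last \<bullet> w $ Last) / (?r \<bullet> ?r)"
    by (simp only: inner_commute)
  then show ?thesis
    by (simp add: metric_G_def X(3) W(3) ip_id_lie_alg[OF X(1) W(1)])
qed

section \<open>The exponentials in the global coordinates\<close>

lemma vector_matrix_rows: "v v* A = (\<Sum>i\<in>UNIV. v $ i *\<^sub>R A $ i)" for A :: "real^'n^'m"
  by (simp add: vec_eq_iff vector_matrix_mult_def mult.commute)

lemma axis_index: "axis a x $ b = (if b = a then x else 0)"
  by (simp add: axis_def)

lemma matrix_zero_mult [simp]: "A ** (0 :: real^'k^'n) = 0" "(0 :: real^'n^'m) ** B = 0"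
  by (simp_all add: vec_eq_iff matrix_matrix_mult_def)

lemma mat_exp_nilpotent:
  assumes "A ** (A ** A) = 0"
  shows "mat_exp A = mat 1 + A + (1/2) *\<^sub>R (A ** A)"
proof -
  let ?p = "\<lambda>k. ((**) A ^^ k) (mat 1)"
  have "?p (3 + k) = 0" for k
    by (induction k) (simp_all add: numeral_3_eq_3 assms)
  then have z: "?p k = 0" if "k \<notin> {0, 1, 2}" for k
    using le_Suc_ex[of 3 k] that by force
  have "mat_exp A = (\<Sum>k\<in>{0, 1, 2}. (1 / fact k) *\<^sub>R ?p k)"
    unfolding mat_exp_def by (rule suminf_finite) (simp_all only: z scaleR_zero_right finite.intros not_False_eq_True)
  then show ?thesis by (simp add: numeral_2_eq_2)
qed

text \<open>From the first power on, the powers of \<open>A\<close> alternate between \<open>A\<close> and \<open>A ** A\<close>, so the series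
  splits into those of \<open>sinh\<close> and \<open>cosh\<close>, with a correction at order zero.\<close>

lemma mat_exp_tripotent:
  assumes "A ** (A ** A) = A"
  shows "mat_exp (s *\<^sub>R A) = mat 1 + sinh s *\<^sub>R A + (cosh s - 1) *\<^sub>R (A ** A)"
proof -
  let ?p = "\<lambda>k. ((**) (s *\<^sub>R A) ^^ k) (mat 1)"
  have p: "?p k = s ^ k *\<^sub>R (if k = 0 then mat 1 else if even k then A ** A else A)" for k
    by (induction k) (auto simp: assms scalar_matrix_assoc[symmetric] matrix_scalar_ac)
  let ?c = "\<lambda>k. if even k then s ^ k /\<^sub>R fact k else 0"
  let ?s = "\<lambda>k. if even k then 0 else s ^ k /\<^sub>R fact k"
  \<comment> \<open>at order zero the even series contributes \<open>A ** A\<close> in place of the identity\<close>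
  have eq: "(1 / fact k) *\<^sub>R ?p k = (if k = 0 then mat 1 - A ** A else 0) + ?c k *\<^sub>R (A ** A) + ?s k *\<^sub>R A"
    for k unfolding p by (simp add: field_simps)
  have "(\<lambda>k. (if k = 0 then mat 1 - A ** A else 0) + ?c k *\<^sub>R (A ** A) + ?s k *\<^sub>R A)
      sums ((mat 1 - A ** A) + cosh s *\<^sub>R (A ** A) + sinh s *\<^sub>R A)"
    by (intro sums_add sums_single sums_scaleR_left cosh_converges sinh_converges)
  then have "mat_exp (s *\<^sub>R A) = (mat 1 - A ** A) + cosh s *\<^sub>R (A ** A) + sinh s *\<^sub>R A"
    unfolding mat_exp_def eq by (rule sums_unique[symmetric])
  then show ?thesis by (simp add: algebra_simps)
qed

text \<open>All products with \<open>\<Sum>\<^sub>i x\<^sub>i N\<^sub>i\<close> are computed row by row.\<close>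

lemma Nmat_sum_rows:
  fixes x :: "real^('m::{finite,linorder})"
  defines "N \<equiv> \<Sum>i\<in>UNIV. (x $ i) *\<^sub>R Nmat i"
  shows "N $ Idx (Idx k) = x $ k *\<^sub>R vsnoc (vsnoc 0 (-1)) 1"
    "N $ Idx Last = vsnoc (vsnoc x 0) 0" "N $ Last = vsnoc (vsnoc x 0) 0"
proof -
  have rows: "Nmat i $ Idx (Idx k) = (if i = k then vsnoc (vsnoc 0 (-1)) 1 else 0)"
    "Nmat i $ Idx Last = vsnoc (vsnoc (axis i 1) 0) 0"
    "Nmat i $ Last = vsnoc (vsnoc (axis i 1) 0) 0" for i k :: 'm
    unfolding vec_eq_iff all_suc_idx by (auto simp: Nmat_def Emat_nth axis_def)
  show "N $ Idx (Idx k) = x $ k *\<^sub>R vsnoc (vsnoc 0 (-1)) 1"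
    unfolding N_def sum_component vector_scaleR_component rows
    by (simp add: if_distrib[of "\<lambda>v. _ *\<^sub>R v"] cong: if_cong)
  have "(\<Sum>i\<in>UNIV. x $ i *\<^sub>R vsnoc (vsnoc (axis i 1) 0) 0) = vsnoc (vsnoc x 0) 0"
    unfolding vec_eq_iff all_suc_idx
    by (simp add: axis_def if_distrib[of "\<lambda>v. _ * v"] cong: if_cong)
  then show "N $ Idx Last = vsnoc (vsnoc x 0) 0" "N $ Last = vsnoc (vsnoc x 0) 0"
    unfolding N_def sum_component vector_scaleR_component rows by blast+
qed

lemma Nmat_sum_vector_matrix:
  fixes x :: "real^('m::{finite,linorder})"
  shows "vsnoc (vsnoc u a) b v* (\<Sum>i\<in>UNIV. (x $ i) *\<^sub>R Nmat i)
    = vsnoc (vsnoc ((a + b) *\<^sub>R x) (- (u \<bullet> x))) (u \<bullet> x)"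
  unfolding vector_matrix_rows sum_suc_idx Nmat_sum_rows vsnoc_nth
  by (simp add: vec_eq_iff all_suc_idx inner_vec_def algebra_simps sum_negf)

lemma Nmat_sum_square_rows:
  fixes x :: "real^('m::{finite,linorder})"
  defines "N \<equiv> \<Sum>i\<in>UNIV. (x $ i) *\<^sub>R Nmat i"
  shows "(N ** N) $ Idx (Idx k) = 0"
    "(N ** N) $ Idx Last = vsnoc (vsnoc 0 (- (x \<bullet> x))) (x \<bullet> x)"
    "(N ** N) $ Last = vsnoc (vsnoc 0 (- (x \<bullet> x))) (x \<bullet> x)"
proof -
  have e: "x $ k *\<^sub>R vsnoc (vsnoc 0 (-1)) 1 = vsnoc (vsnoc 0 (- (x $ k))) (x $ k)"
    by (simp add: vec_eq_iff all_suc_idx)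
  show "(N ** N) $ Idx (Idx k) = 0"
    unfolding N_def mult_row Nmat_sum_rows e Nmat_sum_vector_matrix
    by (simp add: vec_eq_iff all_suc_idx)
  show "(N ** N) $ Idx Last = vsnoc (vsnoc 0 (- (x \<bullet> x))) (x \<bullet> x)"
    "(N ** N) $ Last = vsnoc (vsnoc 0 (- (x \<bullet> x))) (x \<bullet> x)"
    unfolding N_def mult_row Nmat_sum_rows by (simp_all add: Nmat_sum_vector_matrix)
qed

lemma mat_exp_Nmat_sum:
  fixes x :: "real^('m::{finite,linorder})"
  defines "N \<equiv> \<Sum>i\<in>UNIV. (x $ i) *\<^sub>R Nmat i"
  shows "mat_exp N = mat 1 + N + (1/2) *\<^sub>R (N ** N)"
proof (rule mat_exp_nilpotent)
  have z: "0 v* N = 0" by (simp add: vec_eq_iff vector_matrix_mult_def)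
  have v: "vsnoc (vsnoc 0 (- c)) c v* N = 0" for c
    unfolding N_def Nmat_sum_vector_matrix by (simp add: vec_eq_iff all_suc_idx)
  have "((N ** N) ** N) $ a = 0" for a
  proof (cases "\<exists>k. a = Idx (Idx k)")
    case True
    then show ?thesis
      unfolding mult_row[of "N ** N"] using Nmat_sum_square_rows(1)[of x, folded N_def] z by auto
  next
    case False
    then have "(N ** N) $ a = vsnoc (vsnoc 0 (- (x \<bullet> x))) (x \<bullet> x)"
      using Nmat_sum_square_rows(2,3)[of x, folded N_def] by (metis suc_idx.exhaust)
    then show ?thesis
      unfolding mult_row[of "N ** N"] by (simp only: v)
  qed
  then show "N ** (N ** N) = 0"
    unfolding matrix_mul_assoc by (intro vec_eq_iff[THEN iffD2] allI) (simp only: zero_index)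
qed

lemma mat_exp_Nmat_sum_rows:
  fixes x :: "real^('m::{finite,linorder})"
  defines "E \<equiv> mat_exp (\<Sum>i\<in>UNIV. (x $ i) *\<^sub>R Nmat i)"
  shows "E $ Idx (Idx k) = vsnoc (vsnoc (axis k 1) (- (x $ k))) (x $ k)"
    "E $ Idx Last = vsnoc (vsnoc x (1 - x \<bullet> x / 2)) (x \<bullet> x / 2)"
    "E $ Last = vsnoc (vsnoc x (- (x \<bullet> x / 2))) (1 + x \<bullet> x / 2)"
  unfolding E_def mat_exp_Nmat_sum vector_add_component vector_scaleR_component
    Nmat_sum_square_rows Nmat_sum_rows
  by (auto simp: vec_eq_iff all_suc_idx mat_def axis_def)

lemma mat_exp_Nmat_sum_SO0:
  fixes x :: "real^('m::{finite,linorder})"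
  shows "mat_exp (\<Sum>i\<in>UNIV. (x $ i) *\<^sub>R Nmat i) \<in> SO0"
proof -
  let ?E = "\<lambda>x :: (real, 'm) vec. mat_exp (\<Sum>i\<in>UNIV. (x $ i) *\<^sub>R Nmat i)"
  have "range ?E \<subseteq> SO0"
  proof (rule SO0_connected_subset)
    show "connected (range ?E)"
      unfolding mat_exp_Nmat_sum by (intro connected_continuous_image continuous_intros connected_UNIV)
    show "range ?E \<subseteq> pseudo_orthogonal"
    proof clarify
      fix y :: "(real, 'm) vec"
      show "?E y \<in> pseudo_orthogonal"
        unfolding pseudo_orthogonal_iff_lor all_suc_idx mat_exp_Nmat_sum_rows
        by (auto simp: inner_axis inner_axis' axis_index algebra_simps)
    qed
    show "?E 0 \<in> range ?E" by (rule rangeI)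
    show "?E 0 \<in> SO0" unfolding mat_exp_Nmat_sum by (simp add: mat_1_SO0)
  qed
  then show ?thesis by blast
qed

lemma Amat_square: "(Amat :: 'm::{finite,linorder} mat) ** Amat = elem_mat (Idx Last) (Idx Last) + elem_mat Last Last"
proof -
  have rows: "Amat $ Idx (Idx k) = 0" "Amat $ Idx Last = axis Last 1" "Amat $ Last = axis (Idx Last) 1" for k :: 'm
    unfolding vec_eq_iff all_suc_idx by (auto simp: Amat_def Emat_nth axis_def)
  show ?thesis
    unfolding vec_eq_iff[where 'b = "'m suc_idx suc_idx"] all_suc_idx mult_row rows axis_vector_matrix
    by (auto simp: elem_mat_nth axis_def)
qed

lemma mat_exp_Amat: "mat_exp (s *\<^sub>R Amat) = plane_mat (Idx Last) Last (cosh s) (sinh s)"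
proof -
  have "Amat ** (Amat ** Amat) = (Amat :: 'a mat)"
  proof -
    have rows: "Amat $ Idx (Idx k) = 0" "Amat $ Idx Last = axis Last 1" "Amat $ Last = axis (Idx Last) 1" for k :: 'a
      unfolding vec_eq_iff all_suc_idx by (auto simp: Amat_def Emat_nth axis_def)
    show ?thesis
      unfolding vec_eq_iff[where 'b = "'a suc_idx suc_idx"] all_suc_idx mult_row rows axis_vector_matrix Amat_square
      by (auto simp: elem_mat_nth axis_def)
  qed
  then show ?thesis
    by (simp add: mat_exp_tripotent Amat_square plane_mat_def) (simp add: Amat_def)
qed

lemma mat_exp_Amat_SO0: "mat_exp (s *\<^sub>R Amat) \<in> (SO0 :: 'm::{finite,linorder} mat set)"
proof -
  let ?E = "\<lambda>s. mat_exp (s *\<^sub>R Amat) :: 'm mat"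
  have "range ?E \<subseteq> SO0"
  proof (rule SO0_connected_subset)
    show "connected (range ?E)"
      unfolding mat_exp_Amat plane_mat_def
      by (intro connected_continuous_image continuous_intros connected_UNIV)
    show "range ?E \<subseteq> pseudo_orthogonal"
      unfolding mat_exp_Amat by (auto intro!: plane_mat_pseudo_orthogonal simp: cosh_square_eq)
    show "?E 0 \<in> range ?E" by (rule rangeI)
    show "?E 0 \<in> SO0" unfolding mat_exp_Amat by (simp add: mat_1_SO0 plane_mat_def)
  qed
  then show ?thesis by blast
qed

section \<open>The global coordinates in terms of bottom rows\<close>

text \<open>The bottom row of \<open>lift_point (x, y)\<close> in closed form. It parametrizes the upper sheet of the
  hyperboloid; the inverse \<open>hproj\<close> below is the restriction of a linear map, because the last two
  entries add up to \<open>y\<close>.\<close>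

definition hrow :: "'m::{finite,linorder} hcoord \<Rightarrow> (real, 'm idx) vec" where
  "hrow p = (let x = fst p; y = snd p in
     vsnoc (vsnoc x ((y - inverse y) / 2 - (x \<bullet> x / 2) * inverse y))
       ((y + inverse y) / 2 + (x \<bullet> x / 2) * inverse y))"

definition hproj :: "(real, 'm::{finite,linorder} idx) vec \<Rightarrow> 'm hcoord" where
  "hproj r = (vinit (vinit r), vinit r $ Last + r $ Last)"

lemma lift_point_SO0: "lift_point p \<in> SO0"
  by (cases p) (simp add: lift_point_def SO0_mult mat_exp_Nmat_sum_SO0 mat_exp_Amat_SO0)

lemma lift_point_row:
  assumes "snd p > 0"
  shows "lift_point p $ Last = hrow p"
proof (cases p)
  case (Pair x y)
  have y: "y > 0" using assms Pair by simp
  have v: "vsnoc (vsnoc u a) b v* plane_mat (Idx Last) Last c s = vsnoc (vsnoc u (a * c + b * s)) (a * s + b * c)"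
    for u :: "(real, 'a) vec" and a b c s :: real
    unfolding vector_matrix_rows sum_suc_idx vsnoc_nth
    by (simp add: plane_mat_row)
      (simp add: vec_eq_iff all_suc_idx axis_def if_distrib[of "\<lambda>v. _ * v"] cong: if_cong)
  show ?thesis
    using y unfolding Pair lift_point_def hrow_def prod.case mult_row mat_exp_Nmat_sum_rows mat_exp_Amat v
    by (simp add: cosh_ln_real sinh_ln_real Let_def) (simp add: field_simps)
qed

lemma hproj_hrow: "hproj (hrow p) = p"
  by (cases p) (simp add: hproj_def hrow_def Let_def field_simps)

lemma lor_hrow:
  assumes "snd p > 0"
  shows "lor (hrow p) (hrow p) = 1"
proof -
  have "lift_point p \<in> pseudo_orthogonal"
    using lift_point_SO0 SO0_subset by blast
  from lor_self_row_Last[OF this] show ?thesis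
    unfolding lift_point_row[OF assms] .
qed

lemma hrow_Last_pos: "snd p > 0 \<Longrightarrow> hrow p $ Last > 0"
  using SO0_Last_Last[OF lift_point_SO0] by (metis lift_point_row)

text \<open>Write \<open>r = (x, a, b)\<close>. Then \<open>(b - a) (b + a) = 1 + \<bar>x\<bar>\<^sup>2\<close>, so \<open>b + a\<close> is positive and determines
  \<open>b - a\<close>.\<close>

lemma hrow_hproj:
  assumes "lor r r = 1" "r $ Last > 0"
  shows "snd (hproj r) > 0" "hrow (hproj r) = r"
proof -
  define x a b where "x = vinit (vinit r)" and "a = vinit r $ Last" and "b = r $ Last"
  have r: "r = vsnoc (vsnoc x a) b" by (simp add: x_def a_def b_def del: vinit_nth)
  have id: "b * b - a * a = 1 + x \<bullet> x" using assms(1) unfolding r by simp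
  have b: "b > 0" using assms(2) by (simp add: b_def)
  have "a * a < b * b" using id inner_ge_zero[of x] by linarith
  then have "\<bar>a\<bar>\<^sup>2 < b\<^sup>2" by (simp add: power2_eq_square)
  then have "\<bar>a\<bar> < b" by (rule power2_less_imp_less) (use b in simp)
  then have y: "a + b > 0" by linarith
  then show "snd (hproj r) > 0" by (simp add: hproj_def r)
  have "(a + b) * inverse (a + b) = 1" using y by simp
  then have k: "inverse (a + b) + (x \<bullet> x) * inverse (a + b) = b - a"
    using id by algebra
  have "(a + b - i) / 2 - m / 2 = a" "(a + b + i) / 2 + m / 2 = b" if "i + m = b - a" for i m
    using that by (simp_all add: field_simps)
  from this[OF k]
  have 1: "(a + b - inverse (a + b)) / 2 - (x \<bullet> x / 2) * inverse (a + b) = a"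
    and 2: "(a + b + inverse (a + b)) / 2 + (x \<bullet> x / 2) * inverse (a + b) = b"
    by (simp_all only: times_divide_eq_left)
  have "hproj r = (x, a + b)" by (simp add: hproj_def r)
  then show "hrow (hproj r) = r"
    unfolding hrow_def Let_def by (simp only: fst_conv snd_conv 1 2 r)
qed

lemma orbit_eq_hyp_point:
  assumes "g \<in> SO0"
  shows "orbit g = hyp_point (hproj (g $ Last))"
proof -
  have "lor (g $ Last) (g $ Last) = 1" "g $ Last $ Last > 0"
    using assms SO0_subset lor_self_row_Last SO0_Last_Last by blast+
  then have "lift_point (hproj (g $ Last)) $ Last = g $ Last"
    using hrow_hproj lift_point_row by metis
  then show ?thesis
    unfolding hyp_point_def using orbit_eq_iff[OF assms lift_point_SO0] by simp
qed

lemma inj_on_hyp_point: "inj_on hyp_point (UNIV \<times> {0<..})"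
proof (rule inj_onI)
  fix p q :: "'m::{finite,linorder} hcoord"
  assume pq: "p \<in> UNIV \<times> {0<..}" "q \<in> UNIV \<times> {0<..}" "hyp_point p = hyp_point q"
  then have "lift_point p $ Last = lift_point q $ Last"
    unfolding hyp_point_def by (simp add: orbit_eq_iff lift_point_SO0)
  then have "hrow p = hrow q" using pq lift_point_row by (metis mem_Times_iff greaterThan_iff)
  then show "p = q" by (metis hproj_hrow)
qed

lemma hyp_coords_hyp_point: "snd p > 0 \<Longrightarrow> hyp_coords (hyp_point p) = p"
  unfolding hyp_coords_def by (rule inv_into_f_f[OF inj_on_hyp_point]) (cases p, simp)

text \<open>In the global coordinates, the projection to the quotient is the linear map \<open>hproj\<close> applied to
  the bottom row, and so is its differential.\<close>

lemma hyp_coords_orbit: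
  assumes "g \<in> SO0"
  shows "hyp_coords (orbit g) = hproj (g $ Last)" "snd (hproj (g $ Last)) > 0"
    "hrow (hproj (g $ Last)) = g $ Last"
proof -
  have *: "lor (g $ Last) (g $ Last) = 1" "g $ Last $ Last > 0"
    using assms SO0_subset lor_self_row_Last SO0_Last_Last by blast+
  then show "snd (hproj (g $ Last)) > 0" "hrow (hproj (g $ Last)) = g $ Last"
    using hrow_hproj by blast+
  then show "hyp_coords (orbit g) = hproj (g $ Last)"
    by (simp add: orbit_eq_hyp_point[OF assms] hyp_coords_hyp_point)
qed

lemma orbit_image_SO0: "orbit ` (SO0 :: 'm::{finite,linorder} mat set) = hyp_point ` (UNIV \<times> {0<..})"
proof
  show "orbit ` (SO0 :: 'm mat set) \<subseteq> hyp_point ` (UNIV \<times> {0<..})"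
  proof clarify
    fix g :: "'m mat" assume g: "g \<in> SO0"
    then have "hproj (g $ Last) \<in> UNIV \<times> {0<..}"
      using hyp_coords_orbit(2)[OF g] by (simp add: mem_Times_iff)
    then show "orbit g \<in> hyp_point ` (UNIV \<times> {0<..})"
      unfolding orbit_eq_hyp_point[OF g] by (rule imageI)
  qed
  show "hyp_point ` (UNIV \<times> {0<..}) \<subseteq> orbit ` (SO0 :: 'm mat set)"
    unfolding hyp_point_def using lift_point_SO0 by blast
qed

section \<open>The quotient metric\<close>

abbreviation upper_half :: "'m::{finite,linorder} hcoord set" where
  "upper_half \<equiv> UNIV \<times> {0<..}"

lemma open_upper_half: "open (UNIV \<times> {0<..} :: 'm::{finite,linorder} hcoord set)"
  by (intro open_Times) auto

lemma Ck_on_hrow: "Ck_on k upper_half hrow"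
proof -
  note S = open_upper_half
  have x: "Ck_on k upper_half (fst :: 'a hcoord \<Rightarrow> _)" and y: "Ck_on k upper_half (snd :: 'a hcoord \<Rightarrow> _)"
    by (intro Ck_on_linear S bounded_linear_fst bounded_linear_snd)+
  have i: "Ck_on k upper_half (\<lambda>p :: 'a hcoord. inverse (snd p))"
    by (intro Ck_on_inverse S y) auto
  have q: "Ck_on k upper_half (\<lambda>p :: 'a hcoord. ((1/2) * (fst p \<bullet> fst p)) * inverse (snd p))"
    by (intro Ck_on_mult Ck_on_inner Ck_on_const S x i)
  have neg: "Ck_on k upper_half (\<lambda>p :: 'a hcoord. - f p)" if "Ck_on k upper_half f" for f :: "'a hcoord \<Rightarrow> real"
    using Ck_on_linear_comp[OF bounded_linear_minus[OF bounded_linear_ident] S that] by simp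
  have "Ck_on k upper_half (\<lambda>p :: 'a hcoord. vsnoc (vsnoc (fst p)
      ((1/2) * (snd p + - inverse (snd p)) + - (((1/2) * (fst p \<bullet> fst p)) * inverse (snd p))))
      ((1/2) * (snd p + inverse (snd p)) + ((1/2) * (fst p \<bullet> fst p)) * inverse (snd p)))"
    by (intro Ck_on_linear_comp[OF bounded_linear_vsnoc S Ck_on_Pair[OF S], simplified]
        Ck_on_add Ck_on_mult Ck_on_const S x y i q neg)
  then show ?thesis
    by (rule Ck_on_cong[OF S]) (simp add: hrow_def Let_def)
qed

abbreviation dhrow :: "'m::{finite,linorder} hcoord \<Rightarrow> 'm hcoord \<Rightarrow> (real, 'm idx) vec" where
  "dhrow p \<equiv> frechet_derivative hrow (at p)"

lemma hrow_has_derivative: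
  assumes "snd p > 0"
  shows "(hrow has_derivative dhrow p) (at p)"
  using Ck_on_Suc_has_derivative[OF Ck_on_hrow, of p] assms by (simp add: mem_Times_iff)

lemma bounded_linear_hproj: "bounded_linear hproj"
  by (rule linear_conv_bounded_linear[THEN iffD1], rule linearI)
    (simp_all add: hproj_def vec_eq_iff distrib_left)

lemma hproj_dhrow:
  assumes "snd p > 0"
  shows "hproj (dhrow p v) = v"
proof -
  have 1: "((\<lambda>q. hproj (hrow q)) has_derivative (\<lambda>v. hproj (dhrow p v))) (at p)"
    by (rule bounded_linear.has_derivative[OF bounded_linear_hproj hrow_has_derivative[OF assms]])
  have 2: "((\<lambda>q. hproj (hrow q)) has_derivative (\<lambda>v. v)) (at p)"
    by (simp add: hproj_hrow)
  show ?thesis by (rule fun_cong[OF has_derivative_unique[OF 1 2]])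
qed

text \<open>The image of the differential is tangent to the hyperboloid, so that horizontal lifts exist.\<close>

lemma lor_dhrow:
  assumes "snd p > 0"
  shows "lor (hrow p) (dhrow p v) = 0"
proof -
  have 1: "((\<lambda>q. lor (hrow q) (hrow q)) has_derivative
      (\<lambda>v. lor (hrow p) (dhrow p v) + lor (dhrow p v) (hrow p))) (at p)"
    by (rule bounded_bilinear.FDERIV[OF bounded_bilinear_lor
          hrow_has_derivative[OF assms] hrow_has_derivative[OF assms]])
  have 2: "((\<lambda>q. lor (hrow q) (hrow q)) has_derivative (\<lambda>v. 0)) (at p)"
  proof (rule has_derivative_transform_within_open[OF has_derivative_const open_upper_half])
    show "p \<in> upper_half" using assms by (simp add: mem_Times_iff)
    show "1 = lor (hrow q) (hrow q)" if "q \<in> upper_half" for q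
      using that by (simp add: lor_hrow mem_Times_iff)
  qed
  have "lor (hrow p) (dhrow p v) + lor (dhrow p v) (hrow p) = 0"
    by (rule fun_cong[OF has_derivative_unique[OF 1 2]])
  then show ?thesis by (simp add: lor_commute[of "dhrow p v"])
qed

text \<open>Near \<open>0\<close> the bottom row of the curve is \<open>hrow\<close> of its projection; differentiate this.\<close>

lemma dprojD:
  assumes g: "g \<in> SO0" and "dproj g u v"
  shows "u $ Last = dhrow (hproj (g $ Last)) v"
proof -
  obtain c where c: "smooth_curve_in SO0 c" "c 0 = g" "(c has_vector_derivative u) (at 0)"
    and v: "((\<lambda>t. hyp_coords (orbit (c t))) has_vector_derivative v) (at 0)"
    using assms(2) unfolding dproj_def by blast
  obtain e where e: "e > 0" "\<And>t. t \<in> {-e<..<e} \<Longrightarrow> c t \<in> SO0"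
    by (rule smooth_curve_in_mem[OF c(1)]) (rule that)
  have row: "((\<lambda>t. c t $ Last) has_vector_derivative u $ Last) (at 0)"
    by (rule bounded_linear.has_vector_derivative[OF bounded_linear_vec_nth c(3)])
  have "snd (hproj (g $ Last)) > 0" by (rule hyp_coords_orbit(2)[OF g])
  then have "(hrow has_derivative dhrow (hproj (g $ Last))) (at (hyp_coords (orbit (c 0))))"
    using hrow_has_derivative by (simp add: c(2) hyp_coords_orbit(1)[OF g])
  from vector_derivative_diff_chain_within[OF v has_derivative_at_withinI[OF this]]
  have "((\<lambda>t. hrow (hyp_coords (orbit (c t)))) has_vector_derivative dhrow (hproj (g $ Last)) v) (at 0)"
    by (simp add: o_def)
  then have "((\<lambda>t. c t $ Last) has_vector_derivative dhrow (hproj (g $ Last)) v) (at 0)"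
  proof (rule has_vector_derivative_transform_within_open[where S = "{-e<..<e}"])
    show "hrow (hyp_coords (orbit (c t))) = c t $ Last" if "t \<in> {-e<..<e}" for t
      using hyp_coords_orbit[OF e(2)[OF that]] by simp
  qed (use e(1) in auto)
  then show ?thesis using row vector_derivative_unique_at by blast
qed

lemma dprojI:
  assumes g: "g \<in> SO0" and u: "u \<in> tangent_space SO0 g"
  shows "dproj g u (hproj (u $ Last))"
proof -
  obtain c where c: "smooth_curve_in SO0 c" "c 0 = g" "(c has_vector_derivative u) (at 0)"
    using u unfolding tangent_space_def by blast
  obtain e where e: "e > 0" "\<And>t. t \<in> {-e<..<e} \<Longrightarrow> c t \<in> SO0"
    by (rule smooth_curve_in_mem[OF c(1)]) (rule that)
  have "((\<lambda>t. hproj (c t $ Last)) has_vector_derivative hproj (u $ Last)) (at 0)"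
    by (intro bounded_linear.has_vector_derivative[OF bounded_linear_hproj]
        bounded_linear.has_vector_derivative[OF bounded_linear_vec_nth] c(3))
  then have "((\<lambda>t. hyp_coords (orbit (c t))) has_vector_derivative hproj (u $ Last)) (at 0)"
  proof (rule has_vector_derivative_transform_within_open[where S = "{-e<..<e}"])
    show "hproj (c t $ Last) = hyp_coords (orbit (c t))" if "t \<in> {-e<..<e}" for t
      using hyp_coords_orbit(1)[OF e(2)[OF that]] by simp
  qed (use e(1) in auto)
  then show ?thesis unfolding dproj_def using c by blast
qed

text \<open>The quotient metric is the Euclidean metric of the hyperboloid, divided by the squared Euclidean
  norm of the base point. The value does not depend on the group element \<open>g\<close> over the base point,
  because horizontal vectors are measured by their bottom rows alone.\<close>

lemma hyp_metric_eq:
  assumes p: "snd p > 0"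
  shows "hyp_metric (hyp_point p) v w = (dhrow p v \<bullet> dhrow p w) / (hrow p \<bullet> hrow p)"
  unfolding hyp_metric_def
proof (rule the_equality)
  let ?g = "lift_point p"
  note g = lift_point_SO0[of p]
  have row: "?g $ Last = hrow p" by (rule lift_point_row[OF p])
  have "\<exists>u\<in>horizontal_space ?g. u $ Last = dhrow p v \<and> dproj ?g u v" for v
  proof -
    have "lor (?g $ Last) (dhrow p v) = 0" unfolding row by (rule lor_dhrow[OF p])
    then obtain u where u: "u \<in> horizontal_space ?g" "u $ Last = dhrow p v"
      by (rule horizontal_lift_exists[OF g])
    then have "dproj ?g u (hproj (u $ Last))"
      by (intro dprojI g) (simp add: horizontal_space_def)
    then show ?thesis using u hproj_dhrow[OF p] by auto
  qed
  then obtain u u' where u: "u \<in> horizontal_space ?g" "u $ Last = dhrow p v" "dproj ?g u v"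
    and u': "u' \<in> horizontal_space ?g" "u' $ Last = dhrow p w" "dproj ?g u' w"
    by meson
  have "metric_G ?g u u' = (dhrow p v \<bullet> dhrow p w) / (hrow p \<bullet> hrow p)"
    using metric_horizontal[OF g u(1) u'(1)] by (simp add: u u' row)
  then show "\<exists>g\<in>SO0. \<exists>u\<in>horizontal_space g. \<exists>u'\<in>horizontal_space g.
      orbit g = hyp_point p \<and> dproj g u v \<and> dproj g u' w
      \<and> (dhrow p v \<bullet> dhrow p w) / (hrow p \<bullet> hrow p) = metric_G g u u'"
    using g u(1,3) u'(1,3) hyp_point_def by metis
next
  fix r
  assume "\<exists>g\<in>SO0. \<exists>u\<in>horizontal_space g. \<exists>u'\<in>horizontal_space g.
      orbit g = hyp_point p \<and> dproj g u v \<and> dproj g u' w \<and> r = metric_G g u u'"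
  then obtain g u u' where g: "g \<in> SO0" and u: "u \<in> horizontal_space g" "u' \<in> horizontal_space g"
    and orb: "orbit g = hyp_point p" and d: "dproj g u v" "dproj g u' w" and r: "r = metric_G g u u'"
    by blast
  have row: "g $ Last = hrow p"
    using orb orbit_eq_iff[OF g lift_point_SO0] lift_point_row[OF p] by (simp add: hyp_point_def)
  show "r = (dhrow p v \<bullet> dhrow p w) / (hrow p \<bullet> hrow p)"
    unfolding r metric_horizontal[OF g u] dprojD[OF g d(1)] dprojD[OF g d(2)] row hproj_hrow ..
qed

section \<open>Polar coordinates\<close>

text \<open>The point of the hyperboloid at hyperbolic distance \<open>ln t\<close> from the vertex, in direction \<open>e\<close>, for
  \<open>(t, e)\<close> in \<open>(1, \<infinity>) \<times> S\<close>.\<close>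

definition polar_row :: "real \<times> 'm::{finite,linorder} rvec \<Rightarrow> (real, 'm idx) vec" where
  "polar_row q = vsnoc (sinh (ln (fst q)) *\<^sub>R snd q) (cosh (ln (fst q)))"

definition from_polar :: "real \<times> 'm::{finite,linorder} rvec \<Rightarrow> 'm hcoord" where
  "from_polar q = hproj (polar_row q)"

text \<open>If \<open>s\<close> is the norm of the spatial part of the row and \<open>b\<close> its time part, then \<open>s = sinh (ln t)\<close> and
  \<open>b = cosh (ln t)\<close>, so that \<open>t = s + b\<close>.\<close>

definition to_polar :: "'m::{finite,linorder} hcoord \<Rightarrow> real \<times> 'm rvec" where
  "to_polar p = (let s = norm (vinit (hrow p)) in
     (s + hrow p $ Last, inverse s *\<^sub>R vinit (hrow p)))"

definition punctured :: "'m::{finite,linorder} hcoord set" where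
  "punctured = UNIV \<times> {0<..} - {(0, 1)}"

lemma hrow_from_polar:
  assumes "norm (snd q) = 1"
  shows "snd (from_polar q) > 0" "hrow (from_polar q) = polar_row q"
proof -
  have "snd q \<bullet> snd q = 1" using assms by (simp add: dot_square_norm)
  then have "lor (polar_row q) (polar_row q) = 1"
    using hyperbolic_pythagoras[of "ln (fst q)"]
    by (simp add: polar_row_def power2_eq_square)
  moreover have "polar_row q $ Last > 0"
    by (simp add: polar_row_def cosh_real_pos)
  ultimately show "snd (from_polar q) > 0" "hrow (from_polar q) = polar_row q"
    unfolding from_polar_def by (rule hrow_hproj)+
qed

lemma hrow_base: "hrow (0, 1) = vsnoc 0 1"
  by (simp add: hrow_def vec_eq_iff all_suc_idx)

text \<open>The spatial part of the row vanishes only at the vertex of the hyperboloid, which corresponds to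
  the point that is removed. Hence polar coordinates are smooth away from it.\<close>

lemma hrow_punctured:
  assumes "p \<in> punctured"
  defines "s \<equiv> norm (vinit (hrow p))"
  shows "s > 0" "(hrow p $ Last)\<^sup>2 = 1 + s\<^sup>2" "hrow p $ Last > 1"
proof -
  have p: "snd p > 0" using assms by (auto simp: punctured_def)
  show eq: "(hrow p $ Last)\<^sup>2 = 1 + s\<^sup>2"
    using lor_hrow[OF p] by (simp add: lor_def s_def power2_eq_square dot_square_norm[unfolded power2_eq_square])
  have pos: "hrow p $ Last > 0" by (rule hrow_Last_pos[OF p])
  show "s > 0"
  proof (rule ccontr)
    assume "\<not> s > 0"
    then have s0: "s = 0" by (simp add: s_def)
    then have "(hrow p $ Last)\<^sup>2 = 1" using eq by simp
    then have "hrow p $ Last = 1" using pos by (auto simp: power2_eq_1_iff)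
    moreover have "vinit (hrow p) = 0" using s0 by (simp add: s_def)
    ultimately have "hrow p = hrow (0, 1)"
      unfolding hrow_base by (metis vsnoc_vinit)
    then have "p = (0, 1)" by (metis hproj_hrow)
    then show False using assms by (simp add: punctured_def)
  qed
  then have "1\<^sup>2 < (hrow p $ Last)\<^sup>2" unfolding eq by simp
  then show "hrow p $ Last > 1" by (rule power2_less_imp_less) (use pos in simp)
qed

lemma to_polar_mem:
  assumes "p \<in> punctured"
  shows "to_polar p \<in> {1<..} \<times> sphere 0 1"
proof -
  have "norm (vinit (hrow p)) + hrow p $ Last > 1"
    using hrow_punctured(1,3)[OF assms] by linarith
  then show ?thesis
    using hrow_punctured(1)[OF assms] by (simp add: to_polar_def Let_def)
qed

lemma polar_row_to_polar:
  assumes "p \<in> punctured"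
  shows "polar_row (to_polar p) = hrow p"
proof -
  define s b where "s = norm (vinit (hrow p))" and "b = hrow p $ Last"
  have s: "s > 0" and b: "b\<^sup>2 = 1 + s\<^sup>2" "b > 1"
    using hrow_punctured[OF assms] by (simp_all add: s_def b_def)
  have pos: "s + b > 0" using s b by linarith
  \<comment> \<open>\<open>s + b = t\<close> and \<open>b - s = 1 / t\<close>\<close>
  have "(s + b) * (b - s) = 1" using b(1) by algebra
  then have inv: "inverse (s + b) = b - s" by (rule inverse_unique)
  have "sinh (ln (s + b)) = s" "cosh (ln (s + b)) = b"
    using pos by (simp_all add: sinh_ln_real cosh_ln_real inv)
  then have "polar_row (to_polar p) = vsnoc (vinit (hrow p)) (hrow p $ Last)"
    using s unfolding polar_row_def to_polar_def Let_def s_def[symmetric] b_def[symmetric] by simp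
  then show ?thesis by simp
qed

lemma from_polar_to_polar: "p \<in> punctured \<Longrightarrow> from_polar (to_polar p) = p"
  by (simp add: from_polar_def polar_row_to_polar hproj_hrow)

lemma from_polar_mem:
  assumes "q \<in> {1<..} \<times> sphere 0 1"
  shows "from_polar q \<in> punctured"
proof -
  have q: "norm (snd q) = 1" "fst q > 1" using assms by (auto simp: mem_Times_iff)
  have "from_polar q \<noteq> (0, 1)"
  proof
    assume "from_polar q = (0, 1)"
    then have "polar_row q = vsnoc 0 1"
      using hrow_from_polar(2)[OF q(1)] hrow_base by metis
    then have "sinh (ln (fst q)) *\<^sub>R snd q = 0" by (simp add: polar_row_def)
    then show False using q by auto
  qed
  then show ?thesis
    using hrow_from_polar(1)[OF q(1)] by (simp add: punctured_def mem_Times_iff)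
qed

lemma to_polar_from_polar:
  assumes "q \<in> {1<..} \<times> sphere 0 1"
  shows "to_polar (from_polar q) = q"
proof -
  have q: "norm (snd q) = 1" "fst q > 1" using assms by (auto simp: mem_Times_iff)
  have s: "sinh (ln (fst q)) > 0" using q(2) by simp
  have "sinh (ln (fst q)) + cosh (ln (fst q)) = fst q"
    using q(2) by (simp add: sinh_plus_cosh)
  then show ?thesis
    unfolding to_polar_def hrow_from_polar(2)[OF q(1)] Let_def
    using s q by (simp add: polar_row_def prod_eq_iff)
qed

lemma bij_betw_to_polar: "bij_betw to_polar punctured ({1<..} \<times> sphere 0 1)"
  by (rule bij_betw_byWitness[where f' = from_polar])
    (use from_polar_to_polar to_polar_from_polar to_polar_mem from_polar_mem in blast)+

lemma open_punctured: "open punctured"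
  unfolding punctured_def by (intro open_Diff open_upper_half) simp

lemma Ck_on_to_polar: "Ck_on k (punctured :: 'm::{finite,linorder} hcoord set) to_polar"
proof -
  let ?P = "punctured :: 'm hcoord set"
  note S = open_punctured
  have h: "Ck_on k ?P hrow"
    by (rule Ck_on_subset[OF Ck_on_hrow]) (auto simp: punctured_def)
  have i: "Ck_on k ?P (\<lambda>p. vinit (hrow p))"
    by (rule Ck_on_linear_comp[OF bounded_linear_vinit S h])
  have l: "Ck_on k ?P (\<lambda>p. hrow p $ Last)"
    by (rule Ck_on_linear_comp[OF bounded_linear_vec_nth S h])
  have nz: "vinit (hrow p) \<noteq> 0" if "p \<in> punctured" for p :: "'m hcoord"
    using hrow_punctured(1)[OF that] by auto
  have n: "Ck_on k ?P (\<lambda>p. norm (vinit (hrow p)))"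
    by (rule Ck_on_norm[OF S i nz])
  have "Ck_on k ?P (\<lambda>p. (norm (vinit (hrow p)) + hrow p $ Last,
      inverse (norm (vinit (hrow p))) *\<^sub>R vinit (hrow p)))"
    using nz by (intro Ck_on_Pair Ck_on_add Ck_on_scaleR Ck_on_inverse S n l i) auto
  then show ?thesis
    by (rule Ck_on_cong[OF S]) (simp add: to_polar_def Let_def)
qed

lemma Ck_on_from_polar: "Ck_on k ({0<..} \<times> UNIV :: (real \<times> 'm::{finite,linorder} rvec) set) from_polar"
proof -
  let ?S = "{0<..} \<times> UNIV :: (real \<times> 'm rvec) set"
  have S: "open ?S" by (intro open_Times) auto
  have t: "Ck_on k ?S fst" and e: "Ck_on k ?S snd"
    by (intro Ck_on_linear S bounded_linear_fst bounded_linear_snd)+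
  have i: "Ck_on k ?S (\<lambda>q. inverse (fst q))"
    by (intro Ck_on_inverse S t) auto
  have neg: "Ck_on k ?S (\<lambda>q. - inverse (fst q))"
    using Ck_on_linear_comp[OF bounded_linear_minus[OF bounded_linear_ident] S i] by simp
  have "Ck_on k ?S (\<lambda>q. vsnoc (((1/2) * (fst q + - inverse (fst q))) *\<^sub>R snd q)
      ((1/2) * (fst q + inverse (fst q))))"
    by (intro Ck_on_linear_comp[OF bounded_linear_vsnoc S Ck_on_Pair[OF S], simplified]
        Ck_on_add Ck_on_mult Ck_on_scaleR Ck_on_const S t e i neg)
  then have "Ck_on k ?S polar_row"
    by (rule Ck_on_cong[OF S]) (auto simp: polar_row_def sinh_ln_real cosh_ln_real)
  then show ?thesis
    unfolding from_polar_def[abs_def] by (rule Ck_on_linear_comp[OF bounded_linear_hproj S])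
qed

lemma polar_row_has_derivative:
  fixes q :: "real \<times> 'm::{finite,linorder} rvec"
  assumes t: "fst q > 0"
  shows "(polar_row has_derivative (\<lambda>w.
    vsnoc (sinh (ln (fst q)) *\<^sub>R snd w + (fst w * (cosh (ln (fst q)) / fst q)) *\<^sub>R snd q)
      (fst w * (sinh (ln (fst q)) / fst q)))) (at q)"
proof -
  have "((\<lambda>t. sinh (ln t)) has_real_derivative cosh (ln (fst q)) / fst q) (at (fst q))"
    using t by (auto intro!: derivative_eq_intros)
  note ds = DERIV_compose_FDERIV[OF this has_derivative_fst[OF has_derivative_ident]]
  have "((\<lambda>t. cosh (ln t)) has_real_derivative sinh (ln (fst q)) / fst q) (at (fst q))"
    using t by (auto intro!: derivative_eq_intros)
  note dc = DERIV_compose_FDERIV[OF this has_derivative_fst[OF has_derivative_ident]]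
  note sc = has_derivative_scaleR[OF ds has_derivative_snd[OF has_derivative_ident]]
  from bounded_linear.has_derivative[OF bounded_linear_vsnoc has_derivative_Pair[OF sc dc]]
  show ?thesis by (simp add: polar_row_def[abs_def])
qed

lemma polar_row_inner_self:
  assumes "norm (snd q) = 1"
  shows "polar_row q \<bullet> polar_row q = cosh (2 * ln (fst q))"
proof -
  have "snd q \<bullet> snd q = 1" using assms by (simp add: dot_square_norm)
  then show ?thesis
    unfolding mult_2 cosh_add by (simp add: polar_row_def)
qed

abbreviation dto_polar :: "'m::{finite,linorder} hcoord \<Rightarrow> 'm hcoord \<Rightarrow> real \<times> 'm rvec" where
  "dto_polar p \<equiv> frechet_derivative to_polar (at p)"

lemma to_polar_has_derivative:
  assumes "p \<in> punctured"
  shows "(to_polar has_derivative dto_polar p) (at p)"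
  by (rule Ck_on_Suc_has_derivative[OF Ck_on_to_polar assms])

text \<open>Differentiate \<open>e \<bullet> e = 1\<close>.\<close>

lemma snd_dto_polar_orthogonal:
  assumes p: "p \<in> punctured"
  shows "snd (to_polar p) \<bullet> snd (dto_polar p v) = 0"
proof -
  have "((\<lambda>p. snd (to_polar p)) has_derivative (\<lambda>v. snd (dto_polar p v))) (at p)"
    by (rule has_derivative_snd[OF to_polar_has_derivative[OF p]])
  from has_derivative_inner[OF this this]
  have 1: "((\<lambda>p. snd (to_polar p) \<bullet> snd (to_polar p)) has_derivative
      (\<lambda>v. snd (to_polar p) \<bullet> snd (dto_polar p v) + snd (dto_polar p v) \<bullet> snd (to_polar p))) (at p)" .
  have 2: "((\<lambda>p. snd (to_polar p) \<bullet> snd (to_polar p)) has_derivative (\<lambda>v. 0)) (at p)"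
  proof (rule has_derivative_transform_within_open[OF has_derivative_const open_punctured p])
    fix p' :: "'a hcoord" assume "p' \<in> punctured"
    then have "norm (snd (to_polar p')) = 1" using to_polar_mem[of p'] by (auto simp: mem_Times_iff)
    then show "1 = snd (to_polar p') \<bullet> snd (to_polar p')" by (simp add: dot_square_norm)
  qed
  have "snd (to_polar p) \<bullet> snd (dto_polar p v) + snd (dto_polar p v) \<bullet> snd (to_polar p) = 0"
    by (rule fun_cong[OF has_derivative_unique[OF 1 2]])
  then show ?thesis by (simp add: inner_commute)
qed

text \<open>With \<open>S = sinh (ln t)\<close> and \<open>C = cosh (ln t)\<close>, the differential of \<open>(S e, C)\<close> has the orthogonal
  components \<open>S de\<close>, \<open>C dt/t\<close> and \<open>S dt/t\<close>. Both the coefficient \<open>C\<^sup>2 + S\<^sup>2\<close> of \<open>dt\<^sup>2/t\<^sup>2\<close> and the squared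
  norm of the base point equal \<open>cosh (2 ln t)\<close>, which leaves \<open>dt\<^sup>2/t\<^sup>2 + S\<^sup>2 / cosh (2 ln t) \<bar>de\<bar>\<^sup>2\<close>.\<close>

lemma hyp_metric_polar:
  assumes p: "p \<in> punctured"
  defines "t \<equiv> fst (to_polar p)"
  shows "hyp_metric (hyp_point p) v w =
    fst (dto_polar p v) * fst (dto_polar p w) / t\<^sup>2
    + (sinh (ln t))\<^sup>2 / cosh (2 * ln t) * (snd (dto_polar p v) \<bullet> snd (dto_polar p w))"
proof -
  let ?S = "sinh (ln t)" and ?C = "cosh (ln t)" and ?e = "snd (to_polar p)" and ?D = "dto_polar p"
  have te: "t > 1" "norm ?e = 1"
    using to_polar_mem[OF p] by (auto simp: t_def mem_Times_iff)
  have sp: "snd p > 0" using p by (auto simp: punctured_def)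
  have "(polar_row has_derivative (\<lambda>w. vsnoc (?S *\<^sub>R snd w + (fst w * (?C / t)) *\<^sub>R ?e)
      (fst w * (?S / t)))) (at (to_polar p))"
    using polar_row_has_derivative[of "to_polar p"] te by (simp add: t_def)
  from has_derivative_compose[OF to_polar_has_derivative[OF p] this]
  have "((\<lambda>p. polar_row (to_polar p)) has_derivative
      (\<lambda>v. vsnoc (?S *\<^sub>R snd (?D v) + (fst (?D v) * (?C / t)) *\<^sub>R ?e) (fst (?D v) * (?S / t)))) (at p)" .
  then have "(hrow has_derivative
      (\<lambda>v. vsnoc (?S *\<^sub>R snd (?D v) + (fst (?D v) * (?C / t)) *\<^sub>R ?e) (fst (?D v) * (?S / t)))) (at p)"
    by (rule has_derivative_transform_within_open[OF _ open_punctured p]) (rule polar_row_to_polar)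
  then have dh: "dhrow p = (\<lambda>v. vsnoc (?S *\<^sub>R snd (?D v) + (fst (?D v) * (?C / t)) *\<^sub>R ?e) (fst (?D v) * (?S / t)))"
    by (rule has_derivative_unique[OF hrow_has_derivative[OF sp]])
  have ee: "?e \<bullet> ?e = 1" using te by (simp add: dot_square_norm)
  have orth: "?e \<bullet> snd (?D v) = 0" "snd (?D v) \<bullet> ?e = 0" for v
    using snd_dto_polar_orthogonal[OF p] by (simp_all add: inner_commute)
  have "dhrow p v \<bullet> dhrow p w = ?S\<^sup>2 * (snd (?D v) \<bullet> snd (?D w))
      + fst (?D v) * fst (?D w) * (?C * ?C + ?S * ?S) / t\<^sup>2"
    unfolding dh inner_vsnoc
    by (simp add: inner_add_left inner_add_right ee orth power2_eq_square add_divide_distrib algebra_simps)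
  moreover have "hrow p \<bullet> hrow p = ?C * ?C + ?S * ?S" and c2: "cosh (2 * ln t) = ?C * ?C + ?S * ?S"
    using polar_row_inner_self[of "to_polar p"] te polar_row_to_polar[OF p]
    unfolding mult_2 cosh_add by (simp_all add: t_def)
  moreover have "?C * ?C + ?S * ?S > 0"
    unfolding c2[symmetric] by (rule cosh_real_pos)
  ultimately show ?thesis
    unfolding hyp_metric_eq[OF sp] by (simp add: add_divide_distrib)
qed

section \<open>The warped product\<close>

lemma punctured_image: "hyp_point ` punctured = orbit ` SO0 - {hyp_point (0, 1)}"
proof -
  have "hyp_point ` (upper_half - {(0, 1)}) = hyp_point ` upper_half - hyp_point ` {(0, 1)}"
    by (rule inj_on_image_set_diff[OF inj_on_hyp_point]) auto
  then show ?thesis by (simp add: punctured_def orbit_image_SO0)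
qed

lemma hyp_coords_hyp_point_punctured: "p \<in> punctured \<Longrightarrow> hyp_coords (hyp_point p) = p"
  by (rule hyp_coords_hyp_point) (auto simp: punctured_def)

text \<open>The ray \<open>{0} \<times> (1, \<infinity>)\<close> is the polar ray in the last spatial direction, parametrized by \<open>t\<close> itself.\<close>

lemma to_polar_axis:
  assumes "t > 1"
  shows "(0 :: (real, 'm::{finite,linorder}) vec, t) \<in> punctured"
    "to_polar (0 :: (real, 'm) vec, t) = (t, vsnoc 0 1)"
proof -
  let ?q = "(t, vsnoc 0 1 :: 'm rvec)"
  have "norm (vsnoc 0 1 :: 'm rvec) = 1" by (simp add: norm_eq_sqrt_inner)
  then have q: "?q \<in> {1<..} \<times> sphere 0 1" using assms by simp
  have "from_polar ?q = (0, t)"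
    using assms by (simp add: from_polar_def polar_row_def hproj_def sinh_plus_cosh vec_eq_iff)
  then show "(0 :: (real, 'm) vec, t) \<in> punctured" "to_polar (0 :: (real, 'm) vec, t) = ?q"
    using from_polar_mem[OF q] to_polar_from_polar[OF q] by simp_all
qed

lemma dto_polar_axis:
  assumes "t > 1"
  shows "dto_polar (0, t) (0, a) = (a, 0)"
proof -
  have "((\<lambda>s. (0, s)) has_derivative (\<lambda>a. (0, a))) (at t)"
    by (intro has_derivative_Pair has_derivative_const has_derivative_ident)
  from has_derivative_compose[OF this to_polar_has_derivative[OF to_polar_axis(1)[OF assms]]]
  have 1: "((\<lambda>s. to_polar (0, s)) has_derivative (\<lambda>a. dto_polar (0, t) (0, a))) (at t)" .
  have 2: "((\<lambda>s. to_polar (0, s)) has_derivative (\<lambda>a. (a, 0))) (at t)"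
  proof (rule has_derivative_transform_within_open[OF _ open_greaterThan[of 1]])
    show "((\<lambda>s. (s, vsnoc 0 1)) has_derivative (\<lambda>a. (a, 0))) (at t)"
      by (intro has_derivative_Pair has_derivative_const has_derivative_ident)
  qed (use assms in \<open>auto simp: to_polar_axis\<close>)
  show ?thesis by (rule fun_cong[OF has_derivative_unique[OF 1 2]])
qed

lemma ray_metric:
  fixes t a b :: real
  assumes "t > 1"
  defines "ray \<equiv> induced_riem {1<..} (\<lambda>t. hyp_point (0, t))
    (hyp_space :: ('m::{finite,linorder} mat set, 'm hcoord) riem)"
  shows "rm_metric ray t a b = a * b / t\<^sup>2"
proof -
  let ?h = "hyp_coords \<circ> (\<lambda>t. hyp_point (0 :: (real, 'm) vec, t))"
  have "(?h has_derivative (\<lambda>a. (0, a))) (at t)"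
  proof (rule has_derivative_transform_within_open[OF _ open_greaterThan[of 1]])
    show "((\<lambda>s. (0, s)) has_derivative (\<lambda>a. (0 :: (real, 'm) vec, a))) (at t)"
      by (intro has_derivative_Pair has_derivative_const has_derivative_ident)
  qed (use assms in \<open>auto simp: hyp_coords_hyp_point\<close>)
  then have "frechet_derivative ?h (at t) = (\<lambda>a. (0, a))"
    by (rule frechet_derivative_at[symmetric])
  then have "rm_metric ray t a b = hyp_metric (hyp_point (0 :: (real, 'm) vec, t)) (0, a) (0, b)"
    by (simp add: ray_def induced_riem_def hyp_space_def)
  then show ?thesis
    using assms(1) by (simp add: hyp_metric_polar to_polar_axis dto_polar_axis)
qed

text \<open>In the coordinates of the two sides the map is \<open>to_polar\<close>, with inverse \<open>from_polar\<close>. The sphere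
  is not open, so smoothness of the inverse is witnessed by the extension of \<open>from_polar\<close> to all
  vectors \<open>e\<close> and all \<open>t > 0\<close>.\<close>

lemma polar_isometry:
  fixes \<phi> :: "real \<Rightarrow> real"
  assumes \<phi>: "\<And>t. t > 1 \<Longrightarrow> exp (2 * \<phi> t) = (sinh (ln t))\<^sup>2 / cosh (2 * ln t)"
  defines "H \<equiv> hyp_space :: ('m::{finite,linorder} mat set, 'm hcoord) riem"
  defines "M \<equiv> remove_point H (hyp_point (0, 1))"
  defines "N \<equiv> warped_product (induced_riem {1<..} (\<lambda>t. hyp_point (0, t)) H) \<phi>
    (unit_sphere :: ('m rvec, 'm rvec) riem)"
  shows "riem_isometry M N (to_polar \<circ> hyp_coords)"
proof -
  let ?f = "to_polar \<circ> hyp_coords :: 'm mat set \<Rightarrow> real \<times> 'm rvec"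
  let ?T = "{1<..} \<times> sphere 0 1 :: (real \<times> 'm rvec) set"
  have M: "rm_points M = hyp_point ` punctured" "rm_coords M = hyp_coords" "rm_metric M = hyp_metric"
    by (simp_all add: M_def H_def remove_point_def hyp_space_def punctured_image)
  have N: "rm_points N = ?T" "rm_coords N = (\<lambda>q. q)"
    by (simp_all add: N_def warped_product_def induced_riem_def unit_sphere_def map_prod_def)
  have metric_N: "rm_metric N q \<zeta> \<eta> = fst \<zeta> * fst \<eta> / (fst q)\<^sup>2
      + (sinh (ln (fst q)))\<^sup>2 / cosh (2 * ln (fst q)) * (snd \<zeta> \<bullet> snd \<eta>)" if "fst q > 1" for q \<zeta> \<eta>
    using that by (simp add: N_def H_def warped_product_def case_prod_unfold ray_metric \<phi>)
      (simp add: unit_sphere_def)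
  have img: "hyp_coords ` hyp_point ` punctured = (punctured :: 'm hcoord set)"
    by (simp add: image_image hyp_coords_hyp_point_punctured)
  have bij_coords: "bij_betw hyp_coords (hyp_point ` punctured) (punctured :: 'm hcoord set)"
    by (rule bij_betw_byWitness[where f' = hyp_point]) (auto simp: hyp_coords_hyp_point_punctured)
  have bij: "bij_betw ?f (rm_points M) (rm_points N)"
    unfolding M N by (rule bij_betw_trans[OF bij_coords bij_betw_to_polar])
  have rep: "coord_rep M N ?f p = to_polar p" if "p \<in> punctured" for p
  proof -
    have "inv_into (hyp_point ` punctured) hyp_coords p = hyp_point p"
      using that bij_coords
      by (intro inv_into_f_eq) (auto simp: bij_betw_def hyp_coords_hyp_point_punctured)
    then show ?thesis by (simp add: coord_rep_def M N hyp_coords_hyp_point_punctured[OF that])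
  qed
  have rep_inv: "coord_rep N M (inv_into (rm_points M) ?f) q = from_polar q" if q: "q \<in> ?T" for q
  proof -
    have 1: "inv_into ?T (\<lambda>q. q) q = q"
      by (rule inv_into_f_eq) (auto simp: q)
    note m = from_polar_mem[OF q]
    have 2: "inv_into (rm_points M) ?f q = hyp_point (from_polar q)"
      using bij m to_polar_from_polar[OF q]
      by (intro inv_into_f_eq) (auto simp: bij_betw_def M hyp_coords_hyp_point_punctured)
    show ?thesis
      unfolding coord_rep_def M(2) N o_apply 1 2 by (rule hyp_coords_hyp_point_punctured[OF m])
  qed
  show ?thesis
    unfolding riem_isometry_def
  proof (intro conjI ballI allI impI)
    show "bij_betw ?f (rm_points M) (rm_points N)" by (rule bij)
    show "smooth_map_on (rm_coords M ` rm_points M) (coord_rep M N ?f)"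
      unfolding M(1,2) img smooth_map_on_def smooth_on_open_def
      using open_punctured Ck_on_to_polar rep by (metis IntD1)
    show "smooth_map_on (rm_coords N ` rm_points N) (coord_rep N M (inv_into (rm_points M) ?f))"
      unfolding smooth_map_on_def smooth_on_open_def
    proof
      fix q assume "q \<in> rm_coords N ` rm_points N"
      then have q: "q \<in> ?T" by (simp add: N)
      show "\<exists>U F. q \<in> U \<and> (open U \<and> (\<forall>k. Ck_on k U F)) \<and>
          (\<forall>x\<in>rm_coords N ` rm_points N \<inter> U. F x = coord_rep N M (inv_into (rm_points M) ?f) x)"
      proof (intro exI conjI allI ballI)
        show "q \<in> {0<..} \<times> UNIV" using q by auto
        show "open ({0<..} \<times> UNIV :: (real \<times> 'm rvec) set)" by (intro open_Times) auto
        show "Ck_on k ({0<..} \<times> UNIV) from_polar" for k by (rule Ck_on_from_polar)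
        show "from_polar x = coord_rep N M (inv_into (rm_points M) ?f) x"
          if "x \<in> rm_coords N ` rm_points N \<inter> {0<..} \<times> UNIV" for x
          using that rep_inv[of x] by (simp add: N)
      qed
    qed
  next
    fix P c c'
    assume P: "P \<in> rm_points M"
      and "smooth_curve_in (rm_coords M ` rm_points M) c \<and> c 0 = rm_coords M P \<and>
        smooth_curve_in (rm_coords M ` rm_points M) c' \<and> c' 0 = rm_coords M P"
    then have c: "smooth_curve_in punctured c" "c 0 = hyp_coords P"
      and c': "smooth_curve_in punctured c'" "c' 0 = hyp_coords P"
      unfolding M(1,2) img by simp_all
    obtain p where p: "p \<in> punctured" "P = hyp_point p" using P M(1) by blast
    have coords: "hyp_coords P = p" unfolding p(2) by (rule hyp_coords_hyp_point_punctured[OF p(1)])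
    have velocity: "vector_derivative (coord_rep M N ?f \<circ> c) (at 0) = dto_polar p (vector_derivative c (at 0))"
      if c: "smooth_curve_in punctured c" and c0: "c 0 = p" for c
    proof (rule vector_derivative_at)
      obtain e where e: "e > 0" "\<And>t. t \<in> {-e<..<e} \<Longrightarrow> c t \<in> punctured"
        by (rule smooth_curve_in_mem[OF c]) (rule that)
      have "(to_polar has_derivative dto_polar p) (at (c 0) within range c)"
        unfolding c0 by (rule has_derivative_at_withinI[OF to_polar_has_derivative[OF p(1)]])
      from vector_derivative_diff_chain_within[OF smooth_curve_in_vector_derivative[OF c] this]
      show "((coord_rep M N ?f \<circ> c) has_vector_derivative dto_polar p (vector_derivative c (at 0))) (at 0)"
      proof (rule has_vector_derivative_transform_within_open[where S = "{-e<..<e}"])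
        show "(to_polar \<circ> c) t = (coord_rep M N ?f \<circ> c) t" if "t \<in> {-e<..<e}" for t
          using rep[OF e(2)[OF that]] by simp
      qed (use e(1) in auto)
    qed
    have t: "fst (to_polar p) > 1" using to_polar_mem[OF p(1)] by (auto simp: mem_Times_iff)
    have fP: "?f P = to_polar p" by (simp add: coords)
    show "rm_metric N (?f P) (vector_derivative (coord_rep M N ?f \<circ> c) (at 0))
        (vector_derivative (coord_rep M N ?f \<circ> c') (at 0)) =
      rm_metric M P (vector_derivative c (at 0)) (vector_derivative c' (at 0))"
      using c c' unfolding coords fP M(3)
      by (simp only: velocity metric_N[OF t] p(2) hyp_metric_polar[OF p(1)])
  qed
qed

theorem theorem4p11:
  fixes \<phi> :: "real \<Rightarrow> real"
  assumes "\<And>t. t > 1 \<Longrightarrow> exp (2 * \<phi> t) = (sinh (ln t))\<^sup>2 / cosh (2 * ln t)"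
  shows "let \<H> = hyp_space :: ('m::{finite,linorder} mat set, 'm hcoord) riem;
             ray = induced_riem {1<..} (\<lambda>t. hyp_point (0, t)) \<H>;
             S = unit_sphere :: ('m rvec, 'm rvec) riem
         in (\<forall>t>1. sqrt (rm_metric ray t 1 1) = 1 / t) \<and>
            riem_isometric (remove_point \<H> (hyp_point (0, 1))) (warped_product ray \<phi> S)"
proof -
  have "sqrt (1 * 1 / t\<^sup>2) = 1 / t" if "t > 1" for t :: real
    using that by (simp add: real_sqrt_divide)
  then show ?thesis
    unfolding Let_def riem_isometric_def using polar_isometry[OF assms] ray_metric
    by metis
qed

end
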